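(* Let $\mathbb{K}\in\{\mathbb{R},\mathbb{C}\}$ and let $(\mathfrak{F},\ell)$ be an $L_\infty[1]$-algebra over $\mathbb{K}$ whose underlying cochain complex $$\mathfrak{F}=\big(\mathfrak{F}^{-1}\xrightarrow{\mathrm{d}}\mathfrak{F}^0\xrightarrow{\mathrm{d}}\cdots\xrightarrow{\mathrm{d}}\mathfrak{F}^N\big)$$ is concentrated in degrees $\{-1,0,\dots,N\}$ for some integer $N\ge-1$, with all $\mathfrak{F}^i$ finite-dimensional vector spaces. If the restriction $$\ell_2|_{\mathsf{H}^{-1}}:\mathsf{H}^{-2}(\mathrm{Sym}^2\,\mathfrak{F})=\textstyle\bigwedge^2(\mathsf{H}^{-1}\mathfrak{F})\longrightarrow\mathsf{H}^{-1}\mathfrak{F}$$ of the $\ell_2$ bracket to the cohomology $\mathsf{H}^{-1}\mathfrak{F}$ is non-vanishing, then there does not exist a Møller map $(\mathrm{Sym}\,\mathfrak{F}^\ast[[\lambda]],\delta_0)\to(\mathrm{Sym}\,\mathfrak{F}^\ast[[\lambda]],\delta_0+\delta)$.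
   Context: Complexes are cochain complexes of $\mathbb{K}$-vector spaces (differential of degree $+1$), with Koszul signs throughout. $\underline{\mathrm{hom}}(V,W)$ is the internal hom complex with differential $\partial(L)=\mathrm{d}L-(-1)^{|L|}L\mathrm{d}$. $\mathrm{Sym}\,V=\bigoplus_{n\ge0}(V^{\otimes n})_{\Sigma_n}$ is the graded symmetric algebra. An $L_\infty[1]$-algebra $(\mathfrak{F},\ell)$ is a cochain complex $(\mathfrak{F},\mathrm{d})$ with degree $1$ linear maps $\ell_n:\mathrm{Sym}^n\mathfrak{F}\to\mathfrak{F}$, $n\ge1$, with $\ell_1=\mathrm{d}$, satisfying for all $n\geq 1$ $$\sum_{i+j=n+1}\ell_i\,(\ell_j\otimes\mathrm{id}^{\otimes (i-1)})\sum_{\sigma\in\mathrm{Sh}(j,i-1)}\gamma_\sigma=0,$$ where $\mathrm{Sh}(j,i-1)$ are the shuffles and $\gamma_\sigma$ is the permutation action with Koszul signs. When $\mathfrak{F}$ is concentrated in degrees $\ge-1$, $\mathsf{H}^{-1}\mathfrak{F}=\ker(\mathrm{d}:\mathfrak{F}^{-1}\to\mathfrak{F}^0)$, and the identity for $n=2$ shows that $\ell_2$ maps $\bigwedge^2\mathsf{H}^{-1}\mathfrak{F}$ into $\mathsf{H}^{-1}\mathfrak{F}$; this is $\ell_2|_{\mathsf{H}^{-1}}$. $\mathfrak{F}^\ast=\underline{\mathrm{hom}}(\mathfrak{F},\mathbb{K})$ is the dual complex. Dualizing $\ell_n$ gives degree $1$ maps $\ell_n^\ast:\mathfrak{F}^\ast\to(\mathrm{Sym}^n\mathfrak{F})^\ast\cong\mathrm{Sym}^n\mathfrak{F}^\ast$,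 $\ell_n^\ast(\varphi)=-(-1)^{|\varphi|}\varphi\circ\ell_n$, where $\varphi_1\cdots\varphi_n\in\mathrm{Sym}^n\mathfrak{F}^\ast$ is identified with the functional $\sum_{\sigma\in\Sigma_n}(\varphi_1\otimes\cdots\otimes\varphi_n)\circ\gamma_\sigma$ on $\mathrm{Sym}^n\mathfrak{F}$. The Chevalley-Eilenberg differential $\delta_{\mathrm{CE}}=\delta_0+\delta$ is the $\mathbb{K}[[\lambda]]$-linear degree $1$ derivation of $\mathrm{Sym}\,\mathfrak{F}^\ast[[\lambda]]$ ($\lambda$ a formal parameter of degree $0$) given on generators by $\delta_0=\ell_1^\ast$ and $\delta=\sum_{n\ge2}\lambda^{n-1}\ell_n^\ast$ (both extended as derivations). The homotopy Jacobi identities give $(\delta_0+\delta)^2=0$. A Møller map is a cochain map $K=\sum_{n\ge0}\lambda^nK_n:(\mathrm{Sym}\,\mathfrak{F}^\ast[[\lambda]],\delta_0)\to(\mathrm{Sym}\,\mathfrak{F}^\ast[[\lambda]],\delta_0+\delta)$, with $K_n$ degree $0$ linear endomorphisms of $\mathrm{Sym}\,\mathfrak{F}^\ast$ and $K_0=\mathrm{id}$; i.e. $(\delta_0+\delta)K=K\delta_0$. *)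

theory Defs
  imports Complex_Main "HOL-Library.Poly_Mapping" "HOL-Library.Function_Algebras"
    "HOL-Combinatorics.Permutations"
begin

section \<open>Ground field\<close>

text \<open>Up to isomorphism of fields, the only members of this class are the real and the complex
  numbers.\<close>

class real_or_complex = field_char_0 +
  assumes real_or_complex:
    "\<exists>h :: 'a \<Rightarrow> complex. inj h \<and> h 1 = 1 \<and> (\<forall>x y. h (x + y) = h x + h y \<and> h (x * y) = h x * h y)
       \<and> (range h = \<real> \<or> range h = UNIV)"

instance real :: real_or_complex
  by standard (rule exI[of _ complex_of_real], auto simp: inj_def Reals_def)

instance complex :: real_or_complex
  by standard (rule exI[of _ "\<lambda>x. x"], auto)


section \<open>Graded vector spaces and cochain complexes\<close>

text \<open>The whole type is the internal direct sum of the homogeneous components \<open>V i\<close>.\<close>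

locale graded_vector_space = vector_space scale
  for scale :: "'k::field \<Rightarrow> 'v::ab_group_add \<Rightarrow> 'v" +
  fixes V :: "int \<Rightarrow> 'v set"
  assumes subspace_component: "subspace (V i)"
    and direct_sum:
      "\<exists>!f. (\<forall>i. f i \<in> V i) \<and> finite {i. f i \<noteq> 0} \<and> v = (\<Sum>i | f i \<noteq> 0. f i)"

locale cochain_complex = graded_vector_space +
  fixes d :: "'b \<Rightarrow> 'b"
  assumes d_linear: "Vector_Spaces.linear scale scale d"
    and d_degree: "v \<in> V i \<Longrightarrow> d v \<in> V (i + 1)"
    and d_square: "d (d v) = 0"

definition homogeneous :: "(int \<Rightarrow> 'v set) \<Rightarrow> 'v set"
  where "homogeneous V = (\<Union>i. V i)"

text \<open>For \<open>v = 0\<close> the degree is an arbitrary fixed integer. It is used only in Koszul signs and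
  degrees of tensors with a factor \<open>v\<close>, all of which vanish in that case.\<close>

definition hdeg :: "(int \<Rightarrow> 'v set) \<Rightarrow> 'v \<Rightarrow> int"
  where "hdeg V v = (SOME i. v \<in> V i)"

text \<open>The dual complex: a functional of degree \<open>i\<close> lives on the component of degree \<open>- i\<close> and is
  extended by zero to the other components.\<close>

definition dual_scale :: "'k::field \<Rightarrow> ('v \<Rightarrow> 'k) \<Rightarrow> 'v \<Rightarrow> 'k"
  where "dual_scale c \<phi> = (\<lambda>v. c * \<phi> v)"

definition dual_grading ::
    "('k::field \<Rightarrow> 'v::ab_group_add \<Rightarrow> 'v) \<Rightarrow> (int \<Rightarrow> 'v set) \<Rightarrow> int \<Rightarrow> ('v \<Rightarrow> 'k) set"
  where "dual_grading scale V i =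
    {\<phi>. Vector_Spaces.linear scale (*) \<phi> \<and> (\<forall>j v. j \<noteq> - i \<longrightarrow> v \<in> V j \<longrightarrow> \<phi> v = 0)}"


section \<open>The graded symmetric algebra\<close>

text \<open>With concatenation as addition on lists, \<open>'v list \<Rightarrow>\<^sub>0 'k\<close> is the free associative
  algebra on the set \<open>'v\<close>. The word \<open>[v\<^sub>1, \<dots>, v\<^sub>n]\<close> in homogeneous letters stands for
  \<open>v\<^sub>1 \<otimes> \<dots> \<otimes> v\<^sub>n\<close>.\<close>

instantiation list :: (type) monoid_add
begin
definition zero_list :: "'a list" where "zero_list = []"
definition plus_list :: "'a list \<Rightarrow> 'a list \<Rightarrow> 'a list" where "plus_list xs ys = xs @ ys"
instance by standard (auto simp: zero_list_def plus_list_def)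
end

type_synonym ('v, 'k) free_alg = "'v list \<Rightarrow>\<^sub>0 'k"

definition fscale :: "'k::field \<Rightarrow> ('v, 'k) free_alg \<Rightarrow> ('v, 'k) free_alg"
  where "fscale c p = Poly_Mapping.map ((*) c) p"

abbreviation word :: "'v list \<Rightarrow> ('v, 'k::field) free_alg"
  where "word vs \<equiv> Poly_Mapping.single vs 1"

text \<open>The sign for passing from \<open>v\<^sub>0 \<otimes> \<dots> \<otimes> v\<^bsub>n-1\<^esub>\<close>, with degrees \<open>ds\<close>, to
  \<open>v\<^bsub>\<sigma> 0\<^esub> \<otimes> \<dots> \<otimes> v\<^bsub>\<sigma> (n-1)\<^esub>\<close>, the latter being \<open>permute_list \<sigma> [v\<^sub>0, \<dots>, v\<^bsub>n-1\<^esub>]\<close>.\<close>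

definition koszul :: "(nat \<Rightarrow> nat) \<Rightarrow> int list \<Rightarrow> 'k::field"
  where "koszul \<sigma> ds =
    (\<Prod>(i, j) \<in> {(i, j). i < j \<and> j < length ds \<and> \<sigma> j < \<sigma> i}. (- 1) powi (ds ! \<sigma> i * ds ! \<sigma> j))"

text \<open>Dividing by the first family of relations gives the tensor powers of \<open>V\<close>, dividing also by the
  second one their coinvariants under the symmetric groups.\<close>

definition multilinear_relations ::
    "('k::field \<Rightarrow> 'v::ab_group_add \<Rightarrow> 'v) \<Rightarrow> (int \<Rightarrow> 'v set) \<Rightarrow> ('v, 'k) free_alg set"
  where "multilinear_relations scale V =
    {word (xs @ [scale a u + scale b v] @ ys)
       - fscale a (word (xs @ [u] @ ys)) - fscale b (word (xs @ [v] @ ys)) | xs ys a b u v i.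
     set xs \<subseteq> homogeneous V \<and> set ys \<subseteq> homogeneous V \<and> u \<in> V i \<and> v \<in> V i}"

definition coinvariant_relations :: "(int \<Rightarrow> 'v set) \<Rightarrow> ('v, 'k::field) free_alg set"
  where "coinvariant_relations V =
    {word vs - fscale (koszul \<sigma> (map (hdeg V) vs)) (word (permute_list \<sigma> vs)) | \<sigma> vs.
     set vs \<subseteq> homogeneous V \<and> \<sigma> permutes {..<length vs}}"

definition sym_null ::
    "('k::field \<Rightarrow> 'v::ab_group_add \<Rightarrow> 'v) \<Rightarrow> (int \<Rightarrow> 'v set) \<Rightarrow> ('v, 'k) free_alg set"
  where "sym_null scale V =
    module.span fscale (multilinear_relations scale V \<union> coinvariant_relations V)"

text \<open>Elements of \<open>Sym V\<close> are cosets of \<open>sym_null\<close>.\<close>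

type_synonym ('v, 'k) sym = "('v, 'k) free_alg set"

definition sym_class ::
    "('k::field \<Rightarrow> 'v::ab_group_add \<Rightarrow> 'v) \<Rightarrow> (int \<Rightarrow> 'v set) \<Rightarrow> ('v, 'k) free_alg \<Rightarrow> ('v, 'k) sym"
  where "sym_class scale V p = {q. q - p \<in> sym_null scale V}"

abbreviation monomial ::
    "('k::field \<Rightarrow> 'v::ab_group_add \<Rightarrow> 'v) \<Rightarrow> (int \<Rightarrow> 'v set) \<Rightarrow> 'v list \<Rightarrow> ('v, 'k) sym"
  where "monomial scale V vs \<equiv> sym_class scale V (word vs)"

definition rep :: "('v, 'k) sym \<Rightarrow> ('v, 'k::field) free_alg"
  where "rep A = (SOME p. p \<in> A)"

definition sym_add ::
    "('k::field \<Rightarrow> 'v::ab_group_add \<Rightarrow> 'v) \<Rightarrow> (int \<Rightarrow> 'v set) \<Rightarrow> ('v, 'k) sym \<Rightarrow> ('v, 'k) sym \<Rightarrow> ('v, 'k) sym"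
  where "sym_add scale V A B = sym_class scale V (rep A + rep B)"

definition sym_scale ::
    "('k::field \<Rightarrow> 'v::ab_group_add \<Rightarrow> 'v) \<Rightarrow> (int \<Rightarrow> 'v set) \<Rightarrow> 'k \<Rightarrow> ('v, 'k) sym \<Rightarrow> ('v, 'k) sym"
  where "sym_scale scale V c A = sym_class scale V (fscale c (rep A))"

definition sym_sum ::
    "('k::field \<Rightarrow> 'v::ab_group_add \<Rightarrow> 'v) \<Rightarrow> (int \<Rightarrow> 'v set) \<Rightarrow> ('i \<Rightarrow> ('v, 'k) sym) \<Rightarrow> 'i set \<Rightarrow> ('v, 'k) sym"
  where "sym_sum scale V A I = sym_class scale V (\<Sum>i\<in>I. rep (A i))"

definition words :: "(int \<Rightarrow> 'v set) \<Rightarrow> nat \<Rightarrow> 'v list set"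
  where "words V n = {vs. set vs \<subseteq> homogeneous V \<and> length vs = n}"

definition Sym ::
    "('k::field \<Rightarrow> 'v::ab_group_add \<Rightarrow> 'v) \<Rightarrow> (int \<Rightarrow> 'v set) \<Rightarrow> ('v, 'k) sym set"
  where "Sym scale V = sym_class scale V ` module.span fscale (word ` (\<Union>n. words V n))"

definition Sym_pow ::
    "('k::field \<Rightarrow> 'v::ab_group_add \<Rightarrow> 'v) \<Rightarrow> (int \<Rightarrow> 'v set) \<Rightarrow> nat \<Rightarrow> ('v, 'k) sym set"
  where "Sym_pow scale V n = sym_class scale V ` module.span fscale (word ` words V n)"

definition Sym_deg ::
    "('k::field \<Rightarrow> 'v::ab_group_add \<Rightarrow> 'v) \<Rightarrow> (int \<Rightarrow> 'v set) \<Rightarrow> int \<Rightarrow> ('v, 'k) sym set"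
  where "Sym_deg scale V e = sym_class scale V `
    module.span fscale (word ` {vs \<in> (\<Union>n. words V n). sum_list (map (hdeg V) vs) = e})"


section \<open>\<open>L\<^sub>\<infinity>[1]\<close>-algebras\<close>

definition shuffles_perm :: "nat \<Rightarrow> nat \<Rightarrow> (nat \<Rightarrow> nat) set"
  where "shuffles_perm p q =
    {\<sigma>. \<sigma> permutes {..<p + q} \<and> strict_mono_on {..<p} \<sigma> \<and> strict_mono_on {p..<p + q} \<sigma>}"

locale Linf1_algebra = cochain_complex scale F d
  for scale :: "'k::field \<Rightarrow> 'v::ab_group_add \<Rightarrow> 'v" and F :: "int \<Rightarrow> 'v set" and d :: "'v \<Rightarrow> 'v" +
  fixes l :: "nat \<Rightarrow> ('v, 'k) sym \<Rightarrow> 'v"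
  assumes l_add: "\<lbrakk>n \<ge> 1; A \<in> Sym_pow scale F n; B \<in> Sym_pow scale F n\<rbrakk>
      \<Longrightarrow> l n (sym_add scale F A B) = l n A + l n B"
    and l_scale: "\<lbrakk>n \<ge> 1; A \<in> Sym_pow scale F n\<rbrakk>
      \<Longrightarrow> l n (sym_scale scale F c A) = scale c (l n A)"
    and l_degree: "\<lbrakk>n \<ge> 1; A \<in> Sym_pow scale F n \<inter> Sym_deg scale F e\<rbrakk> \<Longrightarrow> l n A \<in> F (e + 1)"
    and l_1: "v \<in> homogeneous F \<Longrightarrow> l 1 (monomial scale F [v]) = d v"
    and homotopy_Jacobi: "\<lbrakk>n \<ge> 1; vs \<in> words F n\<rbrakk> \<Longrightarrow>
      (\<Sum>(i, j) \<in> {(i, j). i \<ge> 1 \<and> j \<ge> 1 \<and> i + j = n + 1}. \<Sum>\<sigma>\<in>shuffles_perm j (i - 1).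
         scale (koszul \<sigma> (map (hdeg F) vs))
           (l i (monomial scale F
              (l j (monomial scale F (take j (permute_list \<sigma> vs))) # drop j (permute_list \<sigma> vs))))) = 0"

text \<open>The cohomology in degree \<open>-1\<close>, for complexes concentrated in degrees at least \<open>-1\<close>, and the
  image of its exterior square (a symmetric square of odd elements) in \<open>Sym\<^sup>2 F\<close>.\<close>

definition H_minus_1 :: "(int \<Rightarrow> 'v::ab_group_add set) \<Rightarrow> ('v \<Rightarrow> 'v) \<Rightarrow> 'v set"
  where "H_minus_1 F d = {x \<in> F (- 1). d x = 0}"

definition wedge2_H ::
    "('k::field \<Rightarrow> 'v::ab_group_add \<Rightarrow> 'v) \<Rightarrow> (int \<Rightarrow> 'v set) \<Rightarrow> ('v \<Rightarrow> 'v) \<Rightarrow> ('v, 'k) sym set"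
  where "wedge2_H scale F d = sym_class scale F `
    module.span fscale {word [x, y] | x y. x \<in> H_minus_1 F d \<and> y \<in> H_minus_1 F d}"


section \<open>The Chevalley-Eilenberg differential\<close>

text \<open>\<open>(\<phi>\<^sub>0 \<otimes> \<dots> \<otimes> \<phi>\<^bsub>n-1\<^esub>) (v\<^sub>0 \<otimes> \<dots> \<otimes> v\<^bsub>n-1\<^esub>)\<close>; the sign arises from moving each
  \<open>\<phi>\<^sub>j\<close> past all \<open>v\<^sub>i\<close> with \<open>i < j\<close>.\<close>

definition tensor_eval ::
    "('k::field \<Rightarrow> 'v::ab_group_add \<Rightarrow> 'v) \<Rightarrow> (int \<Rightarrow> 'v set) \<Rightarrow> ('v \<Rightarrow> 'k) list \<Rightarrow> 'v list \<Rightarrow> 'k"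
  where "tensor_eval scale F \<phi>s vs =
    (\<Prod>(i, j) \<in> {(i, j). i < j \<and> j < length vs}.
        (- 1) powi (hdeg (dual_grading scale F) (\<phi>s ! j) * hdeg F (vs ! i))) *
    (\<Prod>i<length vs. (\<phi>s ! i) (vs ! i))"

text \<open>The isomorphism from \<open>Sym\<^sup>n F\<^sup>*\<close> to \<open>(Sym\<^sup>n F)\<^sup>*\<close>, which sends the class of
  \<open>\<phi>\<^sub>1 \<otimes> \<dots> \<otimes> \<phi>\<^sub>n\<close> to the sum of \<open>(\<phi>\<^sub>1 \<otimes> \<dots> \<otimes> \<phi>\<^sub>n) \<circ> \<gamma>\<^sub>\<sigma>\<close> over all
  permutations \<open>\<sigma>\<close>. Functionals on \<open>Sym\<^sup>n F\<close> are recorded by their values on monomials.\<close>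

definition sym_functional ::
    "('k::field \<Rightarrow> 'v::ab_group_add \<Rightarrow> 'v) \<Rightarrow> (int \<Rightarrow> 'v set) \<Rightarrow> nat \<Rightarrow> ('v \<Rightarrow> 'k, 'k) sym \<Rightarrow> 'v list \<Rightarrow> 'k"
  where "sym_functional scale F n A = (\<lambda>vs\<in>words F n.
    \<Sum>\<phi>s \<in> {\<phi>s \<in> Poly_Mapping.keys (rep A). length \<phi>s = n}. Poly_Mapping.lookup (rep A) \<phi>s *
      (\<Sum>\<sigma> | \<sigma> permutes {..<n}.
         koszul \<sigma> (map (hdeg F) vs) * tensor_eval scale F \<phi>s (permute_list \<sigma> vs)))"

definition l_dual ::
    "('k::field \<Rightarrow> 'v::ab_group_add \<Rightarrow> 'v) \<Rightarrow> (int \<Rightarrow> 'v set) \<Rightarrow> (nat \<Rightarrow> ('v, 'k) sym \<Rightarrow> 'v) \<Rightarrow>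
      nat \<Rightarrow> ('v \<Rightarrow> 'k) \<Rightarrow> ('v \<Rightarrow> 'k, 'k) sym"
  where "l_dual scale F l n \<phi> =
    inv_into (Sym_pow dual_scale (dual_grading scale F) n) (sym_functional scale F n)
      (\<lambda>vs\<in>words F n. - ((- 1) powi hdeg (dual_grading scale F) \<phi>) * \<phi> (l n (monomial scale F vs)))"

text \<open>The extension of a degree \<open>1\<close> map \<open>g : V \<rightarrow> Sym V\<close> to a derivation of \<open>Sym V\<close>,
  computed on representatives in the free algebra.\<close>

definition free_derivation_word ::
    "(int \<Rightarrow> 'v set) \<Rightarrow> ('v \<Rightarrow> ('v, 'k) sym) \<Rightarrow> 'v list \<Rightarrow> ('v, 'k::field) free_alg"
  where "free_derivation_word V g vs =
    (\<Sum>k<length vs. fscale ((- 1) powi sum_list (map (hdeg V) (take k vs)))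
       (word (take k vs) * rep (g (vs ! k)) * word (drop (Suc k) vs)))"

definition free_derivation ::
    "(int \<Rightarrow> 'v set) \<Rightarrow> ('v \<Rightarrow> ('v, 'k) sym) \<Rightarrow> ('v, 'k) free_alg \<Rightarrow> ('v, 'k::field) free_alg"
  where "free_derivation V g p =
    (\<Sum>vs\<in>Poly_Mapping.keys p. fscale (Poly_Mapping.lookup p vs) (free_derivation_word V g vs))"

definition sym_derivation ::
    "('k::field \<Rightarrow> 'v::ab_group_add \<Rightarrow> 'v) \<Rightarrow> (int \<Rightarrow> 'v set) \<Rightarrow> ('v \<Rightarrow> ('v, 'k) sym) \<Rightarrow>
      ('v, 'k) sym \<Rightarrow> ('v, 'k) sym"
  where "sym_derivation scale V g A = sym_class scale V (free_derivation V g (rep A))"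

text \<open>On generators \<open>free_derivation\<close> is \<open>g\<close>, and it satisfies the graded Leibniz
  rule.\<close>

lemma fscale_eq: "fscale c p = Poly_Mapping.single 0 c * p"
  by (simp add: fscale_def mult_map_scale_conv_mult)

lemma word_Nil: "word [] = 1"
  unfolding zero_list_def[symmetric] by (rule single_one)

lemma free_derivation_word_eq: "free_derivation V g (word vs) = free_derivation_word V g vs"
  by (simp add: free_derivation_def fscale_eq)

lemma free_derivation_generator: "free_derivation V g (word [v]) = rep (g v)"
  unfolding free_derivation_word_eq
  by (simp add: free_derivation_word_def fscale_eq word_Nil)

lemma free_derivation_Leibniz:
  "free_derivation V g (word us * word vs) =
     free_derivation V g (word us) * word vs +
     fscale ((- 1) powi sum_list (map (hdeg V) us)) (word us * free_derivation V g (word vs))"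
proof -
  let ?t = "\<lambda>ws k. fscale ((- 1) powi sum_list (map (hdeg V) (take k ws)))
       (word (take k ws) * rep (g (ws ! k)) * word (drop (Suc k) ws))"
  let ?s = "(- 1) powi sum_list (map (hdeg V) us)"
  have app: "word (xs @ ys) = word xs * word ys" for xs ys :: "'a list"
    by (simp add: mult_single plus_list_def)
  have central: "p = word xs \<Longrightarrow> p * (Poly_Mapping.single 0 c * q) = Poly_Mapping.single 0 c * (p * q)"
    for xs :: "'a list" and c :: 'b and p q
    by (simp add: mult_single flip: mult.assoc)
  have split: "(\<Sum>k<m + n. f k) = (\<Sum>k<m. f k) + (\<Sum>k<n. f (m + k))"
    for f :: "nat \<Rightarrow> ('a, 'b) free_alg" and m n
    by (induction n) (simp_all add: add.assoc)
  have left: "?t (us @ vs) k = ?t us k * word vs" if "k < length us" for k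
    using that by (simp add: nth_append fscale_eq app mult.assoc)
  have right: "?t (us @ vs) (length us + k) = fscale ?s (word us * ?t vs k)" for k
  proof -
    have "?t (us @ vs) (length us + k) =
        fscale (?s * (- 1) powi sum_list (map (hdeg V) (take k vs)))
          (word us * word (take k vs) * rep (g (vs ! k)) * word (drop (Suc k) vs))"
      by (simp add: app power_int_add)
    also have "\<dots> = fscale ?s (word us * ?t vs k)"
      by (simp add: fscale_eq central mult.assoc) (simp add: mult_single flip: mult.assoc)
    finally show ?thesis .
  qed
  have "free_derivation V g (word us * word vs) = (\<Sum>k<length us + length vs. ?t (us @ vs) k)"
    by (simp only: app[symmetric] free_derivation_word_eq) (simp add: free_derivation_word_def)
  also have "\<dots> = (\<Sum>k<length us. ?t (us @ vs) k) + (\<Sum>k<length vs. ?t (us @ vs) (length us + k))"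
    by (rule split)
  also have "(\<Sum>k<length us. ?t (us @ vs) k) = (\<Sum>k<length us. ?t us k) * word vs"
    unfolding sum_distrib_right by (intro sum.cong refl left) simp
  also have "(\<Sum>k<length vs. ?t (us @ vs) (length us + k)) =
      fscale ?s (word us * (\<Sum>k<length vs. ?t vs k))"
    unfolding right by (simp add: fscale_eq sum_distrib_left)
  finally show ?thesis
    by (simp only: free_derivation_word_eq free_derivation_word_def)
qed

text \<open>Power series in \<open>\<lambda>\<close> over \<open>Sym F\<^sup>*\<close> are the sequences of their coefficients.\<close>

definition Sym_series ::
    "('k::field \<Rightarrow> 'v::ab_group_add \<Rightarrow> 'v) \<Rightarrow> (int \<Rightarrow> 'v set) \<Rightarrow> (nat \<Rightarrow> ('v, 'k) sym) set"
  where "Sym_series scale V = {f. \<forall>m. f m \<in> Sym scale V}"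

context
  fixes scale :: "'k::field \<Rightarrow> 'v::ab_group_add \<Rightarrow> 'v"
    and F :: "int \<Rightarrow> 'v set"
    and l :: "nat \<Rightarrow> ('v, 'k) sym \<Rightarrow> 'v"
begin

abbreviation F_dual :: "int \<Rightarrow> ('v \<Rightarrow> 'k) set"
  where "F_dual \<equiv> dual_grading scale F"

definition l_derivation :: "nat \<Rightarrow> ('v \<Rightarrow> 'k, 'k) sym \<Rightarrow> ('v \<Rightarrow> 'k, 'k) sym"
  where "l_derivation n = sym_derivation dual_scale F_dual (l_dual scale F l n)"

definition delta_0 :: "(nat \<Rightarrow> ('v \<Rightarrow> 'k, 'k) sym) \<Rightarrow> nat \<Rightarrow> ('v \<Rightarrow> 'k, 'k) sym"
  where "delta_0 f = (\<lambda>m. l_derivation 1 (f m))"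

definition delta :: "(nat \<Rightarrow> ('v \<Rightarrow> 'k, 'k) sym) \<Rightarrow> nat \<Rightarrow> ('v \<Rightarrow> 'k, 'k) sym"
  where "delta f = (\<lambda>m. sym_sum dual_scale F_dual
    (\<lambda>n. l_derivation n (f (m - (n - 1)))) {n. n \<ge> 2 \<and> n - 1 \<le> m})"

definition delta_CE :: "(nat \<Rightarrow> ('v \<Rightarrow> 'k, 'k) sym) \<Rightarrow> nat \<Rightarrow> ('v \<Rightarrow> 'k, 'k) sym"
  where "delta_CE f = (\<lambda>m. sym_add dual_scale F_dual (delta_0 f m) (delta f m))"


section \<open>Moller maps\<close>

definition series_map ::
    "(nat \<Rightarrow> ('v \<Rightarrow> 'k, 'k) sym \<Rightarrow> ('v \<Rightarrow> 'k, 'k) sym) \<Rightarrow>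
      (nat \<Rightarrow> ('v \<Rightarrow> 'k, 'k) sym) \<Rightarrow> nat \<Rightarrow> ('v \<Rightarrow> 'k, 'k) sym"
  where "series_map K f = (\<lambda>m. sym_sum dual_scale F_dual (\<lambda>n. K n (f (m - n))) {..m})"

definition sym_endomorphism_deg_0 :: "(('v \<Rightarrow> 'k, 'k) sym \<Rightarrow> ('v \<Rightarrow> 'k, 'k) sym) \<Rightarrow> bool"
  where "sym_endomorphism_deg_0 T \<longleftrightarrow>
    (\<forall>A \<in> Sym dual_scale F_dual. T A \<in> Sym dual_scale F_dual) \<and>
    (\<forall>A \<in> Sym dual_scale F_dual. \<forall>B \<in> Sym dual_scale F_dual.
       T (sym_add dual_scale F_dual A B) = sym_add dual_scale F_dual (T A) (T B)) \<and>
    (\<forall>c. \<forall>A \<in> Sym dual_scale F_dual.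
       T (sym_scale dual_scale F_dual c A) = sym_scale dual_scale F_dual c (T A)) \<and>
    (\<forall>e. \<forall>A \<in> Sym_deg dual_scale F_dual e. T A \<in> Sym_deg dual_scale F_dual e)"

definition moller_map :: "(nat \<Rightarrow> ('v \<Rightarrow> 'k, 'k) sym \<Rightarrow> ('v \<Rightarrow> 'k, 'k) sym) \<Rightarrow> bool"
  where "moller_map K \<longleftrightarrow>
    (\<forall>n. sym_endomorphism_deg_0 (K n)) \<and>
    (\<forall>A \<in> Sym dual_scale F_dual. K 0 A = A) \<and>
    (\<forall>f \<in> Sym_series dual_scale F_dual. delta_CE (series_map K f) = series_map K (delta_0 f))"

end

end

theory Submission
  imports Defs
begin

text \<open>At first order in \<open>\<lambda>\<close> a Moller map gives \<open>\<delta>\<^sub>0 K\<^sub>1 + \<delta>\<^sub>1 = K\<^sub>1 \<delta>\<^sub>0\<close>, with \<open>\<delta>\<^sub>1\<close> the derivation dual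
  to \<open>\<ell>\<^sub>2\<close>; so \<open>\<delta>\<^sub>1\<close> vanishes on \<open>\<delta>\<^sub>0\<close>-cohomology. A functional \<open>\<phi>\<close> on the lowest component of the
  complex has the top degree \<open>1\<close> in the dual, hence is \<open>\<delta>\<^sub>0\<close>-closed, and \<open>\<delta>\<^sub>1 \<phi> = - \<delta>\<^sub>0 (K\<^sub>1 \<phi>)\<close>. Pairing
  with cocycles \<open>x\<close>, \<open>y\<close> of degree \<open>-1\<close> kills the right-hand side and turns the left-hand side into
  \<open>\<phi> (\<ell>\<^sub>2 (x, y))\<close>. As \<open>\<phi>\<close> is arbitrary, \<open>\<ell>\<^sub>2 (x, y) = 0\<close>.\<close>

section \<open>The free algebra\<close>

text \<open>Elements of \<open>Sym\<close> are cosets handled through the arbitrary choice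
  \<open>rep\<close>. The proof therefore works in the free algebra, with linear functionals that
  vanish on the relations and so cannot see the choice. The right-hand side dies under the pairing
  because \<open>\<delta>\<^sub>0\<close> replaces one factor \<phi> by \<phi> composed with
  \<open>d\<close>, up to sign, and \<open>d x = d y = 0\<close>. The two dual brackets are treated
  differently, because \<open>l_dual\<close> is an \<open>inv_into\<close>. In arity one the class
  itself must be known and \<open>\<delta>\<^sub>0\<close> must descend to \<open>Sym\<close>; this
  calls for injectivity of \<open>sym_functional\<close> and for the Koszul sign calculus. In arity
  two only values of the pairing matter, so one preimage is enough, built from a finite dual basis
  and a division by 2; \<open>\<delta>\<^sub>1\<close> is only evaluated on chosen representatives.
  A zero letter has an arbitrary \<open>hdeg\<close>, hence an unpredictable sign. This is harmless
  since words with a zero letter are relations, but it is why the Leibniz sums carry explicit lists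
  of degrees.\<close>

interpretation free_alg: vector_space "fscale :: 'k::field \<Rightarrow> ('v, 'k) free_alg \<Rightarrow> ('v, 'k) free_alg"
  by unfold_locales
    (simp_all add: fscale_eq distrib_left distrib_right single_add mult_single flip: mult.assoc)

lemma word_append: "word (xs @ ys) = word xs * word ys"
  by (simp add: mult_single plus_list_def)

lemma mult_fscale_left: "fscale c p * q = fscale c (p * q)"
  by (simp add: fscale_eq mult.assoc)

lemma word_mult_fscale: "word xs * fscale c q = fscale c (word xs * q)"
  by (simp add: fscale_eq mult_single flip: mult.assoc)

lemma lookup_fscale: "Poly_Mapping.lookup (fscale c p) vs = c * Poly_Mapping.lookup p vs"
  by (simp add: fscale_def Poly_Mapping.map.rep_eq when_def)

text \<open>The derivations, the pairings \<open>eval1\<close> and \<open>eval2\<close> and, on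
  representatives, \<open>sym_functional\<close> all have this form, so linearity is proved
  once.\<close>

definition extend_linear ::
    "('k::field \<Rightarrow> 'b::ab_group_add \<Rightarrow> 'b) \<Rightarrow> ('v list \<Rightarrow> 'b) \<Rightarrow> ('v, 'k) free_alg \<Rightarrow> 'b"
  where "extend_linear s w p = (\<Sum>vs\<in>Poly_Mapping.keys p. s (Poly_Mapping.lookup p vs) (w vs))"

context vector_space
begin

text \<open>Cancellation can make the support of \<open>p + q\<close> smaller than the union of the
  supports, so additivity needs all sums over one common index set.\<close>

lemma extend_linear_superset:
  assumes "finite S" "Poly_Mapping.keys p \<subseteq> S"
  shows "extend_linear scale w p = (\<Sum>vs\<in>S. scale (Poly_Mapping.lookup p vs) (w vs))"
  unfolding extend_linear_def
  by (rule sum.mono_neutral_left) (use assms in \<open>auto simp: in_keys_iff\<close>)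

lemma linear_extend_linear: "Vector_Spaces.linear fscale scale (extend_linear scale w)"
proof -
  have "extend_linear scale w (p + q) = extend_linear scale w p + extend_linear scale w q" for p q
  proof -
    let ?S = "Poly_Mapping.keys p \<union> Poly_Mapping.keys q"
    show ?thesis
      using extend_linear_superset[of ?S "p + q" w] extend_linear_superset[of ?S p w]
        extend_linear_superset[of ?S q w] Poly_Mapping.keys_add[of p q]
      by (simp add: lookup_add scale_left_distrib sum.distrib)
  qed
  moreover have "extend_linear scale w (fscale c p) = scale c (extend_linear scale w p)" for c p
  proof -
    have "Poly_Mapping.keys (fscale c p) \<subseteq> Poly_Mapping.keys p"
      by (auto simp: in_keys_iff lookup_fscale)
    then show ?thesis
      using extend_linear_superset[of "Poly_Mapping.keys p" "fscale c p" w]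
      by (simp add: extend_linear_def lookup_fscale scale_sum_right)
  qed
  ultimately show ?thesis
    by unfold_locales auto
qed

lemma extend_linear_word: "extend_linear scale w (word vs) = w vs"
  by (simp add: extend_linear_def)

end

lemma vector_space_field: "vector_space ((*) :: 'k::field \<Rightarrow> 'k \<Rightarrow> 'k)"
  by unfold_locales (simp_all add: algebra_simps)

lemma subspace_zero_field: "module.subspace (*) {0 :: 'k::field}"
proof -
  interpret vector_space "(*) :: 'k \<Rightarrow> 'k \<Rightarrow> 'k" by (rule vector_space_field)
  show ?thesis by (rule subspace_single_0)
qed

text \<open>Interpreting the field as a vector space over itself would make the reassociating rule
  \<open>a * (b * x) = (a * b) * x\<close> a simplification rule, so facts on functionals are collected here.\<close>

lemma linear_functional:
  fixes f :: "'v::ab_group_add \<Rightarrow> 'k::field"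
  assumes "Vector_Spaces.linear s (*) f"
  shows "f (x + y) = f x + f y" and "f (x - y) = f x - f y" and "f (s c x) = c * f x"
    and "f 0 = 0" and "f (sum g A) = (\<Sum>a\<in>A. f (g a))"
proof -
  interpret f: Vector_Spaces.linear s "(*)" f by fact
  show "f (x + y) = f x + f y" by (rule f.add)
  show "f (x - y) = f x - f y" by (rule f.diff)
  show "f (s c x) = c * f x" by (rule f.scale)
  show "f 0 = 0" by (rule f.zero)
  show "f (sum g A) = (\<Sum>a\<in>A. f (g a))" by (rule f.sum)
qed

lemma linear_functionalI:
  fixes f :: "'v::ab_group_add \<Rightarrow> 'k::field"
  assumes "vector_space s" "\<And>x y. f (x + y) = f x + f y" "\<And>c x. f (s c x) = c * f x"
  shows "Vector_Spaces.linear s (*) f"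
  using assms vector_space_field by (simp add: Vector_Spaces.linear_iff)

lemma free_derivation_eq: "free_derivation V g = extend_linear fscale (free_derivation_word V g)"
  by (simp add: fun_eq_iff free_derivation_def extend_linear_def)

lemma linear_free_derivation: "Vector_Spaces.linear fscale fscale (free_derivation V g)"
  unfolding free_derivation_eq by (rule free_alg.linear_extend_linear)

lemma linear_mapsto_span:
  assumes "Vector_Spaces.linear s t f" "module.subspace t T" "\<And>r. r \<in> R \<Longrightarrow> f r \<in> T"
    and "p \<in> module.span s R"
  shows "f p \<in> T"
proof -
  interpret Vector_Spaces.linear s t f by fact
  show ?thesis
    using assms(4)
    by (induction rule: vs1.span_induct_alt)
      (use assms(2,3) in \<open>auto simp: add scale zero vs2.subspace_0 intro!: vs2.subspace_add vs2.subspace_scale\<close>)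
qed


section \<open>Koszul signs\<close>


lemma koszul_id: "koszul id ds = 1"
  unfolding koszul_def by (rule prod.neutral) auto

lemma koszul_transpose: "koszul (transpose 0 (Suc 0)) [a, b] = (- 1) powi (a * b)"
proof -
  have "{(i, j). i < j \<and> j < length [a, b] \<and> transpose 0 (Suc 0) j < transpose 0 (Suc 0) i} = {(0, 1)}"
    by (auto simp: transpose_def less_Suc_eq)
  then show ?thesis
    unfolding koszul_def by (simp add: mult.commute)
qed

text \<open>Raising the degree of the letter in position \<open>m = \<sigma> k\<close> changes the Koszul sign exactly by the
  signs that a degree one operator picks up in front of that letter, before and after permuting.\<close>

lemma koszul_raise_degree:
  assumes \<sigma>: "\<sigma> permutes {..<length ds}" and k: "k < length ds"
  shows "(- 1) powi sum_list (take (\<sigma> k) ds) * koszul \<sigma> (ds[\<sigma> k := ds ! \<sigma> k + 1]) =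
    (koszul \<sigma> ds * (- 1) powi sum_list (take k (permute_list \<sigma> ds)) :: 'k::field)"
proof -
  let ?n = "length ds" and ?m = "\<sigma> k"
  define e :: "nat \<Rightarrow> 'k" where "e j = (- 1) powi (ds ! \<sigma> j)" for j
  \<comment> \<open>The letters standing in front of letter \<open>?m\<close>: those of
    \<open>P\<close> do so in both orders, those of \<open>Q\<close> only before permuting, those of
    \<open>R\<close> only afterwards. \<open>Q\<close> and \<open>R\<close> give exactly the
    inversions involving that letter.\<close>
  define P where "P = {j. j < k \<and> \<sigma> j < ?m}"
  define Q where "Q = {j. k < j \<and> j < ?n \<and> \<sigma> j < ?m}"
  define R where "R = {j. j < k \<and> ?m < \<sigma> j}"
  define I where "I = {(i, j). i < j \<and> j < ?n \<and> \<sigma> j < \<sigma> i}"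
  have inj: "\<sigma> i = \<sigma> j \<longleftrightarrow> i = j" for i j
    using permutes_inj[OF \<sigma>] by (auto simp: inj_def)
  have m: "?m < ?n" using permutes_in_image[OF \<sigma>, of k] k by simp
  have fin: "finite P" "finite Q" "finite R" unfolding P_def Q_def R_def by auto
  have finI: "finite I"
    by (rule finite_subset[of _ "{..<?n} \<times> {..<?n}"]) (auto simp: I_def)
  have sum_powi: "(- 1 :: 'k) powi sum f A = (\<Prod>a\<in>A. (- 1) powi f a)" if "finite A" for f :: "nat \<Rightarrow> int" and A
    using that by (induction A rule: finite_induct) (simp_all add: power_int_add)
  have s1: "(- 1) powi sum_list (take ?m ds) = prod e P * prod e Q"
  proof -
    have "sum_list (take ?m ds) = (\<Sum>i<?m. ds ! i)"
      using m by (simp add: sum_list_sum_nth atLeast0LessThan)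
    also have "\<dots> = (\<Sum>j\<in>P \<union> Q. ds ! \<sigma> j)"
    proof (rule sum.reindex_bij_betw[symmetric], rule bij_betw_imageI)
      show "inj_on \<sigma> (P \<union> Q)" by (auto simp: inj_on_def inj)
      show "\<sigma> ` (P \<union> Q) = {..<?m}"
      proof (intro equalityI subsetI)
        fix i assume i: "i \<in> {..<?m}"
        then obtain j where j: "\<sigma> j = i" "j < ?n"
          using permutes_image[OF \<sigma>] m by (metis (no_types, lifting) imageE lessThan_iff less_trans)
        with i have "j \<noteq> k" by auto
        with i j show "i \<in> \<sigma> ` (P \<union> Q)" by (auto simp: P_def Q_def)
      qed (auto simp: P_def Q_def)
    qed
    also have "(- 1) powi \<dots> = prod e (P \<union> Q)"
      using fin by (simp add: sum_powi e_def)
    also have "\<dots> = prod e P * prod e Q"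
      using fin by (intro prod.union_disjoint) (auto simp: P_def Q_def)
    finally show ?thesis .
  qed
  have s2: "(- 1) powi sum_list (take k (permute_list \<sigma> ds)) = prod e P * prod e R"
  proof -
    have "sum_list (take k (permute_list \<sigma> ds)) = (\<Sum>j<k. ds ! \<sigma> j)"
      using k by (simp add: sum_list_sum_nth atLeast0LessThan permute_list_nth[OF \<sigma>])
    also have "{..<k} = P \<union> R"
      by (auto simp: P_def R_def) (metis inj less_irrefl linorder_neqE_nat)
    also have "(- 1) powi (\<Sum>j\<in>P \<union> R. ds ! \<sigma> j) = prod e (P \<union> R)"
      using fin by (simp add: sum_powi e_def)
    also have "\<dots> = prod e P * prod e R"
      using fin by (intro prod.union_disjoint) (auto simp: P_def R_def)
    finally show ?thesis .
  qed
  \<comment> \<open>The extra sign of an inversion when the degree of letter \<open>?m\<close> goes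
    up by one: the parity of the other letter.\<close>
  let ?h = "\<lambda>(i, j). if i = k then e j else if j = k then e i else 1"
  have "koszul \<sigma> (ds[?m := ds ! ?m + 1]) =
      (\<Prod>(i, j)\<in>I. (- 1) powi (ds ! \<sigma> i * ds ! \<sigma> j) * (?h (i, j) :: 'k))"
    unfolding koszul_def I_def length_list_update
  proof (intro prod.cong refl, clarify)
    fix i j assume ij: "i < j" "j < ?n" "\<sigma> j < \<sigma> i"
    then have "\<sigma> i < ?n" "\<sigma> j < ?n"
      using permutes_in_image[OF \<sigma>, of i] permutes_in_image[OF \<sigma>, of j] by auto
    with ij show "(- 1 :: 'k) powi (ds[?m := ds ! ?m + 1] ! \<sigma> i * ds[?m := ds ! ?m + 1] ! \<sigma> j) =
        (- 1) powi (ds ! \<sigma> i * ds ! \<sigma> j) * (if i = k then e j else if j = k then e i else 1)"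
      by (auto simp: nth_list_update inj e_def power_int_add algebra_simps)
  qed
  also have "\<dots> = koszul \<sigma> ds * prod ?h I"
    unfolding koszul_def I_def[symmetric] prod.distrib[symmetric] by (intro prod.cong) auto
  also have "prod ?h I = prod ?h ((\<lambda>j. (k, j)) ` Q \<union> (\<lambda>i. (i, k)) ` R)"
    by (rule prod.mono_neutral_right) (use finI k in \<open>auto simp: I_def Q_def R_def image_iff split: if_splits\<close>)
  also have "\<dots> = prod ?h ((\<lambda>j. (k, j)) ` Q) * prod ?h ((\<lambda>i. (i, k)) ` R)"
    using fin by (intro prod.union_disjoint) (auto simp: Q_def R_def)
  also have "prod ?h ((\<lambda>j. (k, j)) ` Q) = prod e Q"
    by (subst prod.reindex) (auto simp: inj_on_def)
  also have "prod ?h ((\<lambda>i. (i, k)) ` R) = prod e R"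
    by (subst prod.reindex) (auto simp: inj_on_def R_def intro!: prod.cong)
  finally have h: "koszul \<sigma> (ds[?m := ds ! ?m + 1]) = koszul \<sigma> ds * (prod e Q * prod e R)" .
  \<comment> \<open>\<open>Q\<close> enters the left-hand side twice, from the prefix and from the
    inversions, so it cancels and \<open>P\<close> and \<open>R\<close> remain.\<close>
  have "prod e Q * prod e Q = 1"
    unfolding prod.distrib[symmetric] by (rule prod.neutral) (simp add: e_def)
  then show ?thesis
    unfolding s1 s2 h by (simp add: algebra_simps)
qed

text \<open>Lets \<sigma> act on a middle factor of a longer word. This is how a coinvariant
  relation survives multiplication by words on both sides in \<open>null_ideal\<close>.\<close>

definition shift_perm :: "nat \<Rightarrow> nat \<Rightarrow> (nat \<Rightarrow> nat) \<Rightarrow> nat \<Rightarrow> nat"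
  where "shift_perm a m \<sigma> i = (if a \<le> i \<and> i < a + m then a + \<sigma> (i - a) else i)"

lemma shift_perm_permutes:
  assumes "\<sigma> permutes {..<m}"
  shows "shift_perm a m \<sigma> permutes {..<a + m + b}"
proof -
  have lt: "\<sigma> i < m" if "i < m" for i
    using permutes_in_image[OF assms, of i] that by simp
  have inj: "\<sigma> i = \<sigma> j \<longleftrightarrow> i = j" for i j
    using permutes_inj[OF assms] by (auto simp: inj_def)
  have "inj_on (shift_perm a m \<sigma>) {..<a + m + b}"
  proof (rule inj_onI)
    fix i j assume eq: "shift_perm a m \<sigma> i = shift_perm a m \<sigma> j"
    have "i - a < m" if "a \<le> i" "i < a + m" for i using that by simp
    from this[of i] this[of j] lt[of "i - a"] lt[of "j - a"] eq show "i = j"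
      by (auto simp: shift_perm_def inj split: if_splits)
  qed
  moreover have "shift_perm a m \<sigma> ` {..<a + m + b} \<subseteq> {..<a + m + b}"
  proof clarify
    fix i assume "i < a + m + b"
    then show "shift_perm a m \<sigma> i < a + m + b"
      using lt[of "i - a"] by (auto simp: shift_perm_def less_diff_conv2)
  qed
  ultimately have "bij_betw (shift_perm a m \<sigma>) {..<a + m + b} {..<a + m + b}"
    by (simp add: bij_betw_def endo_inj_surj)
  then show ?thesis
    by (rule bij_imp_permutes) (auto simp: shift_perm_def)
qed

lemma permute_list_shift_perm:
  assumes "\<sigma> permutes {..<length vs}"
  shows "permute_list (shift_perm (length us) (length vs) \<sigma>) (us @ vs @ ws) = us @ permute_list \<sigma> vs @ ws"
proof (rule nth_equalityI)
  fix i assume "i < length (permute_list (shift_perm (length us) (length vs) \<sigma>) (us @ vs @ ws))"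
  then have i: "i < length (us @ vs @ ws)" by simp
  have lt: "\<sigma> i < length vs" if "i < length vs" for i
    using permutes_in_image[OF assms, of i] that by simp
  have "permute_list (shift_perm (length us) (length vs) \<sigma>) (us @ vs @ ws) ! i
      = (us @ vs @ ws) ! shift_perm (length us) (length vs) \<sigma> i"
    using shift_perm_permutes[OF assms, of "length us" "length ws"] i
    by (intro permute_list_nth) (auto simp: add.assoc)
  also have "\<dots> = (us @ permute_list \<sigma> vs @ ws) ! i"
    using lt[of "i - length us"] permute_list_nth[OF assms, of "i - length us"]
    by (auto simp: shift_perm_def nth_append)
  finally show "permute_list (shift_perm (length us) (length vs) \<sigma>) (us @ vs @ ws) ! i
      = (us @ permute_list \<sigma> vs @ ws) ! i" .
qed simp

text \<open>The positions outside the block are fixed and the block is mapped to itself, so every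
  inversion lies inside the block.\<close>

lemma koszul_shift_perm:
  assumes "\<sigma> permutes {..<length ds}"
  shows "koszul (shift_perm (length as) (length ds) \<sigma>) (as @ ds @ bs) = koszul \<sigma> ds"
proof -
  let ?a = "length as" and ?m = "length ds"
  let ?\<tau> = "shift_perm ?a ?m \<sigma>"
  have lt: "\<sigma> i < ?m" if "i < ?m" for i
    using permutes_in_image[OF assms, of i] that by simp
  let ?f = "\<lambda>(i, j). (?a + i, ?a + j)"
  let ?I = "{(i, j). i < j \<and> j < ?m \<and> \<sigma> j < \<sigma> i}"
  have "{(i, j). i < j \<and> j < length (as @ ds @ bs) \<and> ?\<tau> j < ?\<tau> i} = ?f ` ?I"
  proof (intro equalityI subsetI, clarify)
    fix i j assume ij: "i < j" "j < length (as @ ds @ bs)" "?\<tau> j < ?\<tau> i"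
    have "?a \<le> i \<and> i < ?a + ?m \<and> ?a \<le> j \<and> j < ?a + ?m"
      using ij lt[of "i - ?a"] lt[of "j - ?a"]
      by (auto simp: shift_perm_def less_diff_conv2 split: if_splits)
    with ij have "(i - ?a, j - ?a) \<in> ?I" "(i, j) = ?f (i - ?a, j - ?a)"
      by (auto simp: shift_perm_def)
    then show "(i, j) \<in> ?f ` ?I" by blast
  qed (auto simp: shift_perm_def)
  moreover have "inj_on ?f ?I" by (auto simp: inj_on_def)
  ultimately show ?thesis
    unfolding koszul_def using lt
    by (simp only: prod.reindex)
      (auto intro!: prod.cong simp: shift_perm_def nth_append)
qed


section \<open>The graded symmetric algebra\<close>

text \<open>\<open>graded_vector_space\<close> fails for the dual, as the type
  \<open>'v \<Rightarrow> 'k\<close> also contains nonlinear functions. Uniqueness of the degree of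
  a nonzero element is kept, so that a complex and its dual can be treated alike.\<close>

locale graded_subspaces = vector_space scale
  for scale :: "'k::field \<Rightarrow> 'v::ab_group_add \<Rightarrow> 'v" +
  fixes V :: "int \<Rightarrow> 'v set"
  assumes subspace_V: "subspace (V i)"
    and degree_unique: "\<lbrakk>v \<in> V i; v \<in> V j; v \<noteq> 0\<rbrakk> \<Longrightarrow> i = j"
begin

abbreviation null :: "('v, 'k) free_alg set" where "null \<equiv> sym_null scale V"
abbreviation cls :: "('v, 'k) free_alg \<Rightarrow> ('v, 'k) sym" where "cls \<equiv> sym_class scale V"

definition homogeneous_words :: "'v list set"
  where "homogeneous_words = (\<Union>n. words V n)"

definition homogeneous_span :: "('v, 'k) free_alg set"
  where "homogeneous_span = free_alg.span (word ` homogeneous_words)"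

lemma homogeneous_words_iff: "vs \<in> homogeneous_words \<longleftrightarrow> set vs \<subseteq> homogeneous V"
  by (auto simp: homogeneous_words_def words_def)

lemma hdeg_mem: "v \<in> homogeneous V \<Longrightarrow> v \<in> V (hdeg V v)"
  unfolding homogeneous_def hdeg_def by (auto intro: someI)

lemma hdeg_eq: "\<lbrakk>v \<in> V i; v \<noteq> 0\<rbrakk> \<Longrightarrow> hdeg V v = i"
  by (metis UN_I UNIV_I degree_unique hdeg_mem homogeneous_def)

lemma zero_mem_V [simp]: "0 \<in> V i"
  by (rule subspace_0[OF subspace_V])

lemma homogeneousI: "v \<in> V i \<Longrightarrow> v \<in> homogeneous V"
  by (auto simp: homogeneous_def)

lemma zero_homogeneous [simp]: "0 \<in> homogeneous V"
  by (rule homogeneousI[of _ 0]) simp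

lemma subspace_null: "free_alg.subspace null"
  unfolding sym_null_def by (rule free_alg.subspace_span)

lemmas null_zero = free_alg.subspace_0[OF subspace_null]
  and null_add = free_alg.subspace_add[OF subspace_null]
  and null_diff = free_alg.subspace_diff[OF subspace_null]
  and null_scale = free_alg.subspace_scale[OF subspace_null]
  and null_sum = free_alg.subspace_sum[OF subspace_null]

lemma null_uminus: "p \<in> null \<Longrightarrow> - p \<in> null"
  by (rule free_alg.subspace_neg[OF subspace_null])

lemma null_minus_commute: "p - q \<in> null \<Longrightarrow> q - p \<in> null"
  using null_uminus[of "p - q"] by simp

lemma null_trans: "\<lbrakk>p - q \<in> null; q - r \<in> null\<rbrakk> \<Longrightarrow> p - r \<in> null"
  using null_add[of "p - q" "q - r"] by simp

lemma null_multilinear: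
  assumes "set xs \<subseteq> homogeneous V" "set ys \<subseteq> homogeneous V" "u \<in> V i" "v \<in> V i"
  shows "word (xs @ [scale a u + scale b v] @ ys)
       - fscale a (word (xs @ [u] @ ys)) - fscale b (word (xs @ [v] @ ys)) \<in> null"
  unfolding sym_null_def multilinear_relations_def
  by (rule free_alg.span_base) (use assms in blast)

lemma null_coinvariant:
  assumes "set vs \<subseteq> homogeneous V" "\<sigma> permutes {..<length vs}"
  shows "word vs - fscale (koszul \<sigma> (map (hdeg V) vs)) (word (permute_list \<sigma> vs)) \<in> null"
  unfolding sym_null_def coinvariant_relations_def
  by (rule free_alg.span_base) (use assms in blast)

text \<open>With \<open>T = {0}\<close> it shows that a functional descends to \<open>Sym\<close>,
  with \<open>T = null\<close> that an endomorphism of the free algebra does.\<close>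

lemma null_induct [consumes 1, case_names multilinear coinvariant]:
  assumes "p \<in> null"
    and f: "Vector_Spaces.linear fscale t f" and T: "module.subspace t T"
    and "\<And>xs ys u v i a b. \<lbrakk>set xs \<subseteq> homogeneous V; set ys \<subseteq> homogeneous V; u \<in> V i; v \<in> V i\<rbrakk> \<Longrightarrow>
       f (word (xs @ [scale a u + scale b v] @ ys)
         - fscale a (word (xs @ [u] @ ys)) - fscale b (word (xs @ [v] @ ys))) \<in> T"
    and "\<And>vs \<sigma>. \<lbrakk>set vs \<subseteq> homogeneous V; \<sigma> permutes {..<length vs}\<rbrakk> \<Longrightarrow>
       f (word vs - fscale (koszul \<sigma> (map (hdeg V) vs)) (word (permute_list \<sigma> vs))) \<in> T"
  shows "f p \<in> T"
proof (rule linear_mapsto_span[OF f T])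
  show "p \<in> free_alg.span (multilinear_relations scale V \<union> coinvariant_relations V)"
    using assms(1) by (simp only: sym_null_def)
  fix r :: "('v, 'k) free_alg" assume "r \<in> multilinear_relations scale V \<union> coinvariant_relations V"
  then show "f r \<in> T"
    unfolding multilinear_relations_def coinvariant_relations_def
    using assms(4,5) by blast
qed

lemma homogeneous_comb: "\<lbrakk>u \<in> V i; v \<in> V i\<rbrakk> \<Longrightarrow> scale a u + scale b v \<in> V i"
  by (intro subspace_add[OF subspace_V] subspace_scale[OF subspace_V])

lemma subspace_homogeneous_span: "free_alg.subspace homogeneous_span"
  unfolding homogeneous_span_def by (rule free_alg.subspace_span)

lemma word_homogeneous_span: "set vs \<subseteq> homogeneous V \<Longrightarrow> word vs \<in> homogeneous_span"
  unfolding homogeneous_span_def homogeneous_words_iff[symmetric]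
  by (intro free_alg.span_base imageI)

lemma linear_id_free_alg: "Vector_Spaces.linear fscale fscale (\<lambda>p::('v,'k) free_alg. p)"
  by unfold_locales simp_all

text \<open>Relations involve homogeneous words only. So every representative of an element of
  \<open>Sym\<close>, in particular the one chosen by \<open>rep\<close>, is a combination of
  homogeneous words.\<close>

lemma null_homogeneous_span: "p \<in> null \<Longrightarrow> p \<in> homogeneous_span"
proof (rule null_induct[OF _ linear_id_free_alg subspace_homogeneous_span],
    goal_cases null multilinear coinvariant)
  case (multilinear xs ys u v i a b)
  then show ?case
    by (intro free_alg.subspace_diff free_alg.subspace_scale subspace_homogeneous_span
        word_homogeneous_span) (auto intro: homogeneousI homogeneous_comb)
next
  case (coinvariant vs \<sigma>)
  then show ?case
    by (intro free_alg.subspace_diff free_alg.subspace_scale subspace_homogeneous_span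
        word_homogeneous_span) auto
qed

text \<open>Zero is the one homogeneous vector whose \<open>hdeg\<close> carries no information. As
  words containing it are relations, a wrong sign in front of them does no harm.\<close>

lemma null_zero_letter:
  assumes "set vs \<subseteq> homogeneous V" "0 \<in> set vs"
  shows "word vs \<in> null"
proof -
  obtain xs ys where vs: "vs = xs @ 0 # ys"
    using assms(2) by (meson split_list)
  \<comment> \<open>With both coefficients equal to 0 the multilinear relation reduces to the word
    itself.\<close>
  from null_multilinear[of xs ys 0 0 0 0 0] assms(1) show ?thesis
    by (simp add: vs)
qed

lemma homogeneous_list_all2:
  "list_all2 (\<lambda>v i. v \<in> V i) vs ds \<Longrightarrow> set vs \<subseteq> homogeneous V"
  by (induction rule: list_all2_induct) (auto intro: homogeneousI)

lemma list_all2_hdeg: "set vs \<subseteq> homogeneous V \<Longrightarrow> list_all2 (\<lambda>v i. v \<in> V i) vs (map (hdeg V) vs)"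
  by (induction vs) (auto intro: hdeg_mem)

lemma map_hdeg_eq:
  "\<lbrakk>list_all2 (\<lambda>v i. v \<in> V i) vs ds; 0 \<notin> set vs\<rbrakk> \<Longrightarrow> map (hdeg V) vs = ds"
  by (induction rule: list_all2_induct) (auto intro: hdeg_eq)

text \<open>Without a zero letter the degrees are unique, and otherwise both words are relations.
  The explicit list is needed after applying a degree one map: the raised degrees are known, while
  the letter may have become zero.\<close>

lemma null_coinvariant_degrees:
  assumes ds: "list_all2 (\<lambda>v i. v \<in> V i) vs ds" and \<sigma>: "\<sigma> permutes {..<length vs}"
  shows "word vs - fscale (koszul \<sigma> ds) (word (permute_list \<sigma> vs)) \<in> null"
proof -
  have hom: "set vs \<subseteq> homogeneous V"
    by (rule homogeneous_list_all2[OF ds])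
  show ?thesis
  proof (cases "0 \<in> set vs")
    case True
    then show ?thesis
      using hom \<sigma> by (intro null_diff null_scale null_zero_letter) auto
  next
    case False
    show ?thesis
      using null_coinvariant[OF hom \<sigma>] map_hdeg_eq[OF ds False] by simp
  qed
qed

text \<open>Allows \<open>rep (g v)\<close> inside a word to be exchanged for any other
  representative of the same class.\<close>

lemma null_ideal:
  assumes us: "set us \<subseteq> homogeneous V" and ws: "set ws \<subseteq> homogeneous V" and "p \<in> null"
  shows "word us * p * word ws \<in> null"
proof -
  have lin: "Vector_Spaces.linear fscale fscale (\<lambda>p. word us * p * word ws)"
    by unfold_locales (simp_all add: algebra_simps mult_fscale_left word_mult_fscale)
  show ?thesis
  proof (rule null_induct[OF \<open>p \<in> null\<close> lin subspace_null], goal_cases multilinear coinvariant)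
    case (multilinear xs ys u v i a b)
    have "word ((us @ xs) @ [scale a u + scale b v] @ (ys @ ws))
       - fscale a (word ((us @ xs) @ [u] @ (ys @ ws))) - fscale b (word ((us @ xs) @ [v] @ (ys @ ws))) \<in> null"
      using multilinear us ws by (intro null_multilinear) auto
    then show ?case
      by (simp only: word_append mult_fscale_left word_mult_fscale left_diff_distrib right_diff_distrib mult.assoc)
  next
    case (coinvariant vs \<sigma>)
    let ?vs = "us @ vs @ ws" and ?\<tau> = "shift_perm (length us) (length vs) \<sigma>"
    have "word ?vs - fscale (koszul ?\<tau> (map (hdeg V) ?vs)) (word (permute_list ?\<tau> ?vs)) \<in> null"
      using coinvariant us ws shift_perm_permutes[of \<sigma> "length vs" "length us" "length ws"]
      by (intro null_coinvariant) (auto simp: add.assoc)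
    moreover have "(koszul ?\<tau> (map (hdeg V) ?vs) :: 'k) = koszul \<sigma> (map (hdeg V) vs)"
      using koszul_shift_perm[of \<sigma> "map (hdeg V) vs" "map (hdeg V) us" "map (hdeg V) ws"] coinvariant
      by simp
    ultimately show ?case
      by (simp only: permute_list_shift_perm[OF coinvariant(2)] word_append mult_fscale_left
          word_mult_fscale left_diff_distrib right_diff_distrib mult.assoc)
  qed
qed

lemma cls_eq_iff: "cls p = cls q \<longleftrightarrow> p - q \<in> null"
proof
  assume "cls p = cls q"
  moreover have "p \<in> cls p" by (simp add: sym_class_def null_zero)
  ultimately show "p - q \<in> null" by (simp add: sym_class_def)
next
  assume "p - q \<in> null"
  then show "cls p = cls q"
    using null_trans[of _ p q] null_trans[of _ q p] null_minus_commute[of p q]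
    by (auto simp: sym_class_def)
qed

lemma rep_cls: "rep (cls p) - p \<in> null"
proof -
  have "p \<in> cls p" by (simp add: sym_class_def null_zero)
  then have "rep (cls p) \<in> cls p" unfolding rep_def by (rule someI)
  then show ?thesis by (simp add: sym_class_def)
qed

lemma sym_add_cls: "sym_add scale V (cls p) (cls q) = cls (p + q)"
  unfolding sym_add_def cls_eq_iff using null_add[OF rep_cls[of p] rep_cls[of q]]
  by (simp add: algebra_simps)

lemma sym_scale_cls: "sym_scale scale V c (cls p) = cls (fscale c p)"
  unfolding sym_scale_def cls_eq_iff using null_scale[OF rep_cls[of p], of c]
  by (simp add: free_alg.scale_right_diff_distrib)

lemma linear_rep_cls:
  assumes "Vector_Spaces.linear fscale t f" "\<And>p. p \<in> null \<Longrightarrow> f p = 0"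
  shows "f (rep (cls p)) = f p"
proof -
  interpret f: Vector_Spaces.linear fscale t f by fact
  show ?thesis using assms(2)[OF rep_cls[of p]] by (simp add: f.diff)
qed

lemma Sym_eq: "Sym scale V = cls ` homogeneous_span"
  unfolding Sym_def homogeneous_span_def homogeneous_words_def ..

lemma rep_homogeneous_span:
  assumes "A \<in> Sym scale V"
  shows "rep A \<in> homogeneous_span"
proof -
  obtain p where p: "A = cls p" "p \<in> homogeneous_span"
    using assms unfolding Sym_eq by blast
  then show ?thesis
    using free_alg.subspace_add[OF subspace_homogeneous_span null_homogeneous_span[OF rep_cls[of p]] p(2)]
    by simp
qed

lemma Sym_pow_subset: "Sym_pow scale V n \<subseteq> Sym scale V"
  unfolding Sym_pow_def Sym_def by (intro image_mono free_alg.span_mono) auto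

end


section \<open>Derivations induced by linear maps of degree one\<close>

text \<open>The situation of \<open>\<delta>\<^sub>0\<close>, which sends generators to generators:
  \<open>g v\<close> is a class and \<open>D v\<close> a letter representing it. Linearity is asked
  for within one degree only, because the sign in the dual differential varies with the
  degree.\<close>

locale degree_one_map = graded_subspaces scale V
  for scale :: "'k::field \<Rightarrow> 'v::ab_group_add \<Rightarrow> 'v" and V :: "int \<Rightarrow> 'v set" +
  fixes D :: "'v \<Rightarrow> 'v" and g :: "'v \<Rightarrow> ('v, 'k) sym"
  assumes D_degree: "v \<in> V i \<Longrightarrow> D v \<in> V (i + 1)"
    and D_linear: "\<lbrakk>u \<in> V i; v \<in> V i\<rbrakk> \<Longrightarrow> D (scale a u + scale b v) = scale a (D u) + scale b (D v)"
    and g_eq: "v \<in> homogeneous V \<Longrightarrow> g v = monomial scale V [D v]"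
begin

lemma D_zero: "D 0 = 0"
  using D_linear[of 0 0 0 0 0] by simp

lemma D_homogeneous: "v \<in> homogeneous V \<Longrightarrow> D v \<in> homogeneous V"
  using D_degree by (auto simp: homogeneous_def)

text \<open>\<open>free_derivation_word\<close> modulo relations, freed from \<open>rep\<close> by
  the letter \<open>D v\<close> and from \<open>hdeg\<close> by an explicit list of degrees.\<close>

definition leibniz_sum :: "'v list \<Rightarrow> int list \<Rightarrow> ('v, 'k) free_alg"
  where "leibniz_sum vs ds =
    (\<Sum>k<length vs. fscale ((- 1) powi sum_list (take k ds)) (word (vs[k := D (vs ! k)])))"

lemma set_update_homogeneous:
  "\<lbrakk>set vs \<subseteq> homogeneous V; k < length vs\<rbrakk> \<Longrightarrow> set (vs[k := D (vs ! k)]) \<subseteq> homogeneous V"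
  by (meson D_homogeneous nth_mem set_update_subsetI subsetD)

lemma zero_update:
  assumes "0 \<in> set vs" "k < length vs"
  shows "0 \<in> set (vs[k := D (vs ! k)])"
proof -
  obtain j where j: "j < length vs" "vs ! j = 0"
    using assms(1) by (auto simp: in_set_conv_nth)
  then have "vs[k := D (vs ! k)] ! j = 0"
    using D_zero assms(2) by (auto simp: nth_list_update)
  with j show ?thesis
    by (metis length_list_update nth_mem)
qed

text \<open>Term by term, \<open>rep (g v)\<close> is exchanged for the letter \<open>D v\<close> by
  \<open>null_ideal\<close>. The two signs can disagree only when there is a zero letter, and then
  both terms are relations because \<open>D 0 = 0\<close>.\<close>

lemma free_derivation_word_leibniz:
  assumes ds: "list_all2 (\<lambda>v i. v \<in> V i) vs ds"
  shows "free_derivation_word V g vs - leibniz_sum vs ds \<in> null"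
  unfolding free_derivation_word_def leibniz_sum_def sum_subtractf[symmetric]
proof (intro null_sum)
  fix k assume "k \<in> {..<length vs}"
  then have k: "k < length vs" by simp
  note hom = homogeneous_list_all2[OF ds]
  let ?s = "(- 1) powi sum_list (map (hdeg V) (take k vs)) :: 'k" and ?t = "(- 1) powi sum_list (take k ds) :: 'k"
  let ?q = "word (take k vs) * rep (g (vs ! k)) * word (drop (Suc k) vs) :: ('v, 'k) free_alg"
  let ?w = "word (vs[k := D (vs ! k)]) :: ('v, 'k) free_alg"
  have "word (take k vs) * (rep (g (vs ! k)) - word [D (vs ! k)]) * word (drop (Suc k) vs) \<in> null"
  proof (rule null_ideal)
    show "rep (g (vs ! k)) - word [D (vs ! k)] \<in> null"
      using g_eq[of "vs ! k"] hom k rep_cls by (metis nth_mem subsetD)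
  qed (use hom in \<open>auto dest: in_set_takeD in_set_dropD\<close>)
  moreover have "?w = word (take k vs) * word [D (vs ! k)] * word (drop (Suc k) vs)"
    using k by (simp add: upd_conv_take_nth_drop flip: word_append)
  ultimately have qw: "?q - ?w \<in> null"
    by (simp only: left_diff_distrib right_diff_distrib)
  show "fscale ?s ?q - fscale ?t ?w \<in> null"
  proof (cases "0 \<in> set vs")
    case True
    then have "?w \<in> null"
      using k hom by (intro null_zero_letter zero_update set_update_homogeneous)
    moreover from this have "?q \<in> null"
      using null_add[OF qw] by force
    ultimately show ?thesis
      by (intro null_diff null_scale)
  next
    case False
    then have "?s = ?t"
      using map_hdeg_eq[OF ds] by (simp flip: take_map)
    then show ?thesis
      using null_scale[OF qw, of ?t] by (simp only: free_alg.scale_right_diff_distrib)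
  qed
qed

text \<open>All three words share one list of degrees, so the signs agree even where a combination
  of \<open>u\<close> and \<open>v\<close> is zero.\<close>

lemma leibniz_sum_multilinear:
  assumes xs: "list_all2 (\<lambda>v i. v \<in> V i) xs as" and ys: "list_all2 (\<lambda>v i. v \<in> V i) ys bs"
    and uv: "u \<in> V i" "v \<in> V i"
  shows "leibniz_sum (xs @ [scale a u + scale b v] @ ys) (as @ [i] @ bs)
    - fscale a (leibniz_sum (xs @ [u] @ ys) (as @ [i] @ bs))
    - fscale b (leibniz_sum (xs @ [v] @ ys) (as @ [i] @ bs)) \<in> null"
proof -
  note hom = homogeneous_list_all2[OF xs] homogeneous_list_all2[OF ys]
  have length: "length (xs @ [w] @ ys) = length xs + Suc (length ys)" for w by simp
  let ?W = "\<lambda>w k. word ((xs @ [w] @ ys)[k := D ((xs @ [w] @ ys) ! k)]) :: ('v, 'k) free_alg"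
  have term_null: "?W (scale a u + scale b v) k - fscale a (?W u k) - fscale b (?W v k) \<in> null"
    if k: "k < length xs + Suc (length ys)" for k
  proof -
    \<comment> \<open>The letter hit by \<open>D\<close> lies before, at or after the linear slot;
      at the slot the relation is the one for \<open>D u\<close> and \<open>D v\<close>, one degree
      higher.\<close>
    consider "k < length xs" | "k = length xs" | j where "k = length xs + Suc j" "j < length ys"
      using k by (metis add_less_cancel_left less_Suc_eq_0_disj less_imp_Suc_add linorder_neqE_nat
          add_Suc_right Suc_less_eq)
    then show ?thesis
    proof cases
      case 1
      then have "(xs @ [w] @ ys)[k := D ((xs @ [w] @ ys) ! k)] = xs[k := D (xs ! k)] @ [w] @ ys" for w
        by (simp add: list_update_append nth_append)
      then show ?thesis
        using null_multilinear[OF set_update_homogeneous[OF hom(1) 1] hom(2) uv] by simp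
    next
      case 2
      then have "(xs @ [w] @ ys)[k := D ((xs @ [w] @ ys) ! k)] = xs @ [D w] @ ys" for w
        by (simp add: list_update_append nth_append)
      then show ?thesis
        using null_multilinear[OF hom D_degree[OF uv(1)] D_degree[OF uv(2)]] D_linear[OF uv] by simp
    next
      case 3
      then have "(xs @ [w] @ ys)[k := D ((xs @ [w] @ ys) ! k)] = xs @ [w] @ ys[j := D (ys ! j)]" for w
        by (simp add: list_update_append nth_append)
      then show ?thesis
        using null_multilinear[OF hom(1) set_update_homogeneous[OF hom(2) 3(2)] uv] by simp
    qed
  qed
  have comm: "fscale c (fscale s p) = fscale s (fscale c p)" for c s and p :: "('v, 'k) free_alg"
    by (simp add: mult.commute)
  show ?thesis
    unfolding leibniz_sum_def length free_alg.scale_sum_right sum_subtractf[symmetric]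
  proof (intro null_sum)
    fix k assume "k \<in> {..<length xs + Suc (length ys)}"
    then show "fscale ((- 1) powi sum_list (take k (as @ [i] @ bs))) (?W (scale a u + scale b v) k)
        - fscale a (fscale ((- 1) powi sum_list (take k (as @ [i] @ bs))) (?W u k))
        - fscale b (fscale ((- 1) powi sum_list (take k (as @ [i] @ bs))) (?W v k)) \<in> null"
      using null_scale[OF term_null[of k]]
      by (simp only: comm[of a] comm[of b] free_alg.scale_right_diff_distrib lessThan_iff)
  qed
qed

text \<open>Term \<open>\<sigma> k\<close> on the left matches term \<open>k\<close> on the right:
  the two words are related by \<sigma> with the degree of one letter raised, and
  \<open>koszul_raise_degree\<close> accounts for the signs.\<close>

lemma leibniz_sum_coinvariant:
  assumes ds: "list_all2 (\<lambda>v i. v \<in> V i) vs ds" and \<sigma>: "\<sigma> permutes {..<length vs}"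
  shows "leibniz_sum vs ds
    - fscale (koszul \<sigma> ds) (leibniz_sum (permute_list \<sigma> vs) (permute_list \<sigma> ds)) \<in> null"
proof -
  let ?n = "length vs"
  have len: "length ds = ?n" using list_all2_lengthD[OF ds] by simp
  have mem: "\<sigma> k < ?n" if "k < ?n" for k
    using permutes_in_image[OF \<sigma>, of k] that by simp
  let ?S = "\<lambda>k. (- 1) powi sum_list (take k ds) :: 'k"
  let ?W = "\<lambda>k. word (vs[k := D (vs ! k)]) :: ('v, 'k) free_alg"
  have "leibniz_sum vs ds = (\<Sum>k<?n. fscale (?S (\<sigma> k)) (?W (\<sigma> k)))"
    unfolding leibniz_sum_def
    by (rule sum.reindex_bij_betw[symmetric]) (rule permutes_imp_bij[OF \<sigma>])
  moreover have "fscale (koszul \<sigma> ds) (leibniz_sum (permute_list \<sigma> vs) (permute_list \<sigma> ds)) =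
      (\<Sum>k<?n. fscale (?S (\<sigma> k) * koszul \<sigma> (ds[\<sigma> k := ds ! \<sigma> k + 1]))
        (word (permute_list \<sigma> (vs[\<sigma> k := D (vs ! \<sigma> k)]))))"
  proof -
    have "(permute_list \<sigma> vs)[k := D (permute_list \<sigma> vs ! k)] = permute_list \<sigma> (vs[\<sigma> k := D (vs ! \<sigma> k)])"
      if k: "k < ?n" for k
    proof (rule nth_equalityI)
      fix i assume "i < length ((permute_list \<sigma> vs)[k := D (permute_list \<sigma> vs ! k)])"
      then have i: "i < ?n" by simp
      have \<sigma>': "\<sigma> permutes {..<length (vs[\<sigma> k := D (vs ! \<sigma> k)])}" using \<sigma> by simp
      show "(permute_list \<sigma> vs)[k := D (permute_list \<sigma> vs ! k)] ! i
          = permute_list \<sigma> (vs[\<sigma> k := D (vs ! \<sigma> k)]) ! i"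
        using i k mem permutes_inj[OF \<sigma>]
        by (simp add: nth_list_update permute_list_nth[OF \<sigma>] permute_list_nth[OF \<sigma>'] inj_eq)
    qed simp
    moreover have "?S (\<sigma> k) * koszul \<sigma> (ds[\<sigma> k := ds ! \<sigma> k + 1])
        = koszul \<sigma> ds * (- 1) powi sum_list (take k (permute_list \<sigma> ds))" if "k < ?n" for k
      using that \<sigma> len by (intro koszul_raise_degree) simp_all
    ultimately show ?thesis
      unfolding leibniz_sum_def free_alg.scale_sum_right by (auto intro!: sum.cong)
  qed
  moreover have "fscale (?S (\<sigma> k)) (?W (\<sigma> k)) -
      fscale (?S (\<sigma> k) * koszul \<sigma> (ds[\<sigma> k := ds ! \<sigma> k + 1]))
        (word (permute_list \<sigma> (vs[\<sigma> k := D (vs ! \<sigma> k)]))) \<in> null" if k: "k < ?n" for k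
  proof -
    have "list_all2 (\<lambda>v i. v \<in> V i) (vs[\<sigma> k := D (vs ! \<sigma> k)]) (ds[\<sigma> k := ds ! \<sigma> k + 1])"
      using ds mem[OF k] by (intro list_all2_update_cong D_degree) (auto simp: list_all2_conv_all_nth)
    then have "?W (\<sigma> k) - fscale (koszul \<sigma> (ds[\<sigma> k := ds ! \<sigma> k + 1]))
        (word (permute_list \<sigma> (vs[\<sigma> k := D (vs ! \<sigma> k)]))) \<in> null"
      by (rule null_coinvariant_degrees) (use \<sigma> in simp)
    from null_scale[OF this, of "?S (\<sigma> k)"] show ?thesis
      by (simp only: free_alg.scale_right_diff_distrib free_alg.scale_scale)
  qed
  ultimately show ?thesis
    by (auto simp flip: sum_subtractf intro: null_sum)
qed

text \<open>So the derivation descends to \<open>Sym\<close>: \<open>leibniz_sum\<close> respects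
  both families of relations and differs from the derivation of a word by a relation.\<close>

lemma free_derivation_null:
  assumes "p \<in> null"
  shows "free_derivation V g p \<in> null"
proof -
  interpret D: Vector_Spaces.linear fscale fscale "free_derivation V g"
    by (rule linear_free_derivation)
  have combine: "a' - fscale c b' \<in> null"
    if "a' - a \<in> null" "b' - b \<in> null" "a - fscale c b \<in> null" for a a' b b' c
    using null_diff[OF null_add[OF that(1,3)] null_scale[OF that(2), of c]]
    by (simp add: free_alg.scale_right_diff_distrib)
  show ?thesis
  proof (rule null_induct[OF assms linear_free_derivation subspace_null], goal_cases multilinear coinvariant)
    case (multilinear xs ys u v i a b)
    define as where "as = map (hdeg V) xs"
    define bs where "bs = map (hdeg V) ys"
    have xs: "list_all2 (\<lambda>v i. v \<in> V i) xs as" and ys: "list_all2 (\<lambda>v i. v \<in> V i) ys bs"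
      unfolding as_def bs_def using multilinear by (auto intro: list_all2_hdeg)
    let ?L = "\<lambda>w. leibniz_sum (xs @ [w] @ ys) (as @ [i] @ bs)"
    let ?D = "\<lambda>w. free_derivation_word V g (xs @ [w] @ ys)"
    have L: "?D w - ?L w \<in> null" if "w \<in> V i" for w
      using xs ys that by (intro free_derivation_word_leibniz) (simp add: list_all2_appendI)
    have "?D (scale a u + scale b v) - fscale a (?D u) - fscale b (?D v) \<in> null"
    proof -
      have "(?D (scale a u + scale b v) - ?L (scale a u + scale b v)) - fscale a (?D u - ?L u)
        - fscale b (?D v - ?L v) + (?L (scale a u + scale b v) - fscale a (?L u) - fscale b (?L v)) \<in> null"
        using multilinear by (intro null_add null_diff null_scale L leibniz_sum_multilinear xs ys homogeneous_comb)
      then show ?thesis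
        by (simp add: free_alg.scale_right_diff_distrib)
    qed
    then show ?case
      by (simp only: D.diff D.scale free_derivation_word_eq)
  next
    case (coinvariant vs \<sigma>)
    let ?ds = "map (hdeg V) vs"
    have ds: "list_all2 (\<lambda>v i. v \<in> V i) vs ?ds"
      using coinvariant by (intro list_all2_hdeg)
    have "list_all2 (\<lambda>v i. v \<in> V i) (permute_list \<sigma> vs) (permute_list \<sigma> ?ds)"
      using coinvariant list_all2_hdeg[of "permute_list \<sigma> vs"] by (simp add: permute_list_map)
    from combine[OF free_derivation_word_leibniz[OF ds] free_derivation_word_leibniz[OF this]
        leibniz_sum_coinvariant[OF ds coinvariant(2)]]
    show ?case
      by (simp only: D.diff D.scale free_derivation_word_eq)
  qed
qed

end


section \<open>Dual spaces\<close>

lemma vector_space_dual_scale: "vector_space dual_scale"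
  by unfold_locales (simp_all add: dual_scale_def fun_eq_iff algebra_simps)

lemma dual_scale_apply [simp]: "dual_scale c \<phi> v = c * \<phi> v"
  by (simp add: dual_scale_def)

context graded_vector_space
begin

sublocale graded_subspaces scale V
proof
  show "subspace (V i)" for i by (rule subspace_component)
  fix v i j assume v: "v \<in> V i" "v \<in> V j" "v \<noteq> 0"
  \<comment> \<open>A vector in two components would have two decompositions, each concentrated in
    one of the two degrees.\<close>
  define f where "f a k = (if k = a then v else 0)" for a k :: int
  have zero: "0 \<in> V k" for k by (rule subspace_0[OF subspace_component])
  have "(\<forall>k. f a k \<in> V k) \<and> finite {k. f a k \<noteq> 0} \<and> v = (\<Sum>k | f a k \<noteq> 0. f a k)" if "v \<in> V a" for a
  proof -
    have "{k. f a k \<noteq> 0} = {a}" using v(3) by (auto simp: f_def)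
    then show ?thesis using that zero by (simp add: f_def)
  qed
  then have "f i = f j" using direct_sum[of v] v by blast
  then have "f i i = f j i" by simp
  then show "i = j" using v(3) by (auto simp: f_def split: if_splits)
qed

section \<open>Homogeneous components of a vector\<close>

definition component :: "'v \<Rightarrow> int \<Rightarrow> 'v"
  where "component v = (THE f. (\<forall>i. f i \<in> V i) \<and> finite {i. f i \<noteq> 0} \<and> v = (\<Sum>i | f i \<noteq> 0. f i))"

lemma component_props:
  "component v i \<in> V i" "finite {i. component v i \<noteq> 0}"
  "v = (\<Sum>i | component v i \<noteq> 0. component v i)"
  using theI'[OF direct_sum[of v]] unfolding component_def by auto

lemma component_eqI:
  assumes "\<And>i. f i \<in> V i" "finite S" "\<And>i. i \<notin> S \<Longrightarrow> f i = 0" "v = (\<Sum>i\<in>S. f i)"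
  shows "component v = f"
  unfolding component_def
proof (rule the1_equality[OF direct_sum])
  have sub: "{i. f i \<noteq> 0} \<subseteq> S" using assms(3) by auto
  then show "(\<forall>i. f i \<in> V i) \<and> finite {i. f i \<noteq> 0} \<and> v = (\<Sum>i | f i \<noteq> 0. f i)"
    using assms finite_subset[OF sub] by (auto intro!: sum.mono_neutral_right)
qed

lemma component_comb:
  "component (scale a u + scale b v) = (\<lambda>i. scale a (component u i) + scale b (component v i))"
proof (rule component_eqI)
  let ?S = "{i. component u i \<noteq> 0} \<union> {i. component v i \<noteq> 0}"
  show fin: "finite ?S" using component_props(2) by simp
  show "scale a (component u i) + scale b (component v i) \<in> V i" for i
    by (intro homogeneous_comb component_props)
  show "scale a (component u i) + scale b (component v i) = 0" if "i \<notin> ?S" for i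
    using that by simp
  have "w = (\<Sum>i\<in>?S. component w i)" if "w = u \<or> w = v" for w
    by (subst component_props(3)[of w], rule sum.mono_neutral_left) (use fin that in auto)
  then show "scale a u + scale b v = (\<Sum>i\<in>?S. scale a (component u i) + scale b (component v i))"
    by (simp add: sum.distrib flip: scale_sum_right)
qed

lemma component_of_mem: "v \<in> V i \<Longrightarrow> component v = (\<lambda>j. if j = i then v else 0)"
  by (rule component_eqI[where S = "{i}"]) auto

lemma linear_eq_0:
  assumes "Vector_Spaces.linear scale t f" "\<And>i v. v \<in> V i \<Longrightarrow> f v = 0"
  shows "f v = 0"
proof -
  interpret f: Vector_Spaces.linear scale t f by fact
  have "f v = (\<Sum>i | component v i \<noteq> 0. f (component v i))"
    by (subst component_props(3)[of v]) (rule f.sum)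
  also have "\<dots> = 0" by (intro sum.neutral ballI assms(2)[OF component_props(1)])
  finally show ?thesis .
qed

section \<open>The grading of the dual\<close>

abbreviation Vd :: "int \<Rightarrow> ('v \<Rightarrow> 'k) set" where "Vd \<equiv> dual_grading scale V"

lemma dual_linear: "\<phi> \<in> Vd i \<Longrightarrow> Vector_Spaces.linear scale (*) \<phi>"
  by (simp add: dual_grading_def)

lemma dual_vanish: "\<lbrakk>\<phi> \<in> Vd i; v \<in> V j; j \<noteq> - i\<rbrakk> \<Longrightarrow> \<phi> v = 0"
  by (auto simp: dual_grading_def)

lemma dual_eq_0: "\<lbrakk>\<phi> \<in> Vd i; \<And>v. v \<in> V (- i) \<Longrightarrow> \<phi> v = 0\<rbrakk> \<Longrightarrow> \<phi> = 0"
  using linear_eq_0[OF dual_linear] dual_vanish by (metis ext zero_fun_apply)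

lemma linear_dual_comb:
  assumes "Vector_Spaces.linear scale (*) \<phi>" "Vector_Spaces.linear scale (*) \<psi>"
  shows "Vector_Spaces.linear scale (*) (dual_scale a \<phi> + dual_scale b \<psi>)"
  by (rule linear_functionalI[OF vector_space_axioms])
    (simp_all add: assms[THEN linear_functional(1)] assms[THEN linear_functional(3)] algebra_simps)

lemma dual_comb: "\<lbrakk>\<phi> \<in> Vd i; \<psi> \<in> Vd i\<rbrakk> \<Longrightarrow> dual_scale a \<phi> + dual_scale b \<psi> \<in> Vd i"
  using linear_dual_comb[of \<phi> \<psi> a b] by (auto simp: dual_grading_def)

lemma zero_mem_dual: "0 \<in> Vd i"
proof -
  have "Vector_Spaces.linear scale (*) (0 :: 'v \<Rightarrow> 'k)"
    by (rule linear_functionalI[OF vector_space_axioms]) simp_all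
  then show ?thesis by (simp add: dual_grading_def)
qed

sublocale dual: graded_subspaces dual_scale Vd
proof -
  interpret D: vector_space "dual_scale :: 'k \<Rightarrow> ('v \<Rightarrow> 'k) \<Rightarrow> 'v \<Rightarrow> 'k"
    by (rule vector_space_dual_scale)
  show "graded_subspaces dual_scale Vd"
  proof
    show "D.subspace (Vd i)" for i
    proof (rule D.subspaceI)
      show "0 \<in> Vd i" by (rule zero_mem_dual)
      show "\<phi> + \<psi> \<in> Vd i" if "\<phi> \<in> Vd i" "\<psi> \<in> Vd i" for \<phi> \<psi>
        using dual_comb[OF that, of 1 1] by (simp only: D.scale_one)
      show "dual_scale c \<phi> \<in> Vd i" if "\<phi> \<in> Vd i" for c \<phi>
        using dual_comb[OF that zero_mem_dual, of c 0] by (simp only: D.scale_zero_right add_0_right)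
    qed
    show "i = j" if "\<phi> \<in> Vd i" "\<phi> \<in> Vd j" "\<phi> \<noteq> 0" for \<phi> i j
      using that dual_eq_0[of \<phi> i] dual_vanish[of \<phi> j] by fastforce
  qed
qed

section \<open>Pairings of the dual with one and with two vectors\<close>

lemma dual_hdeg:
  assumes "\<phi> \<in> homogeneous Vd" "v \<in> homogeneous V" "\<phi> v \<noteq> 0"
  shows "hdeg Vd \<phi> = - hdeg V v"
proof -
  have "hdeg V v = - hdeg Vd \<phi>"
    using dual_vanish[OF dual.hdeg_mem[OF assms(1)] hdeg_mem[OF assms(2)]] assms(3) by blast
  then show ?thesis by simp
qed

text \<open>On representatives of elements of \<open>Sym\<close> this is
  \<open>sym_functional\<close> in arity one at the word \<open>[v]\<close>, but it makes sense on
  the whole free algebra.\<close>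

definition eval1 :: "'v \<Rightarrow> ('v \<Rightarrow> 'k, 'k) free_alg \<Rightarrow> 'k"
  where "eval1 v = extend_linear (*) (\<lambda>\<phi>s. if length \<phi>s = 1 then (\<phi>s ! 0) v else 0)"

text \<open>A nonzero pairing forces opposite degrees, so on homogeneous arguments the signs of the pairing
  of \<open>Sym\<^sup>2\<close> of the dual with \<open>u \<otimes> v\<close> only depend on the degrees of \<open>u\<close> and \<open>v\<close>.\<close>

definition eval2 :: "'v \<Rightarrow> 'v \<Rightarrow> ('v \<Rightarrow> 'k, 'k) free_alg \<Rightarrow> 'k"
  where "eval2 u v = extend_linear (*) (\<lambda>\<phi>s. if length \<phi>s = 2
    then (- 1) powi (hdeg V u * hdeg V v) * ((\<phi>s ! 0) u * (\<phi>s ! 1) v) + (\<phi>s ! 0) v * (\<phi>s ! 1) u else 0)"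

lemma linear_eval1: "Vector_Spaces.linear fscale (*) (eval1 v)"
  unfolding eval1_def by (rule vector_space.linear_extend_linear[OF vector_space_field])

lemma linear_eval2: "Vector_Spaces.linear fscale (*) (eval2 u v)"
  unfolding eval2_def by (rule vector_space.linear_extend_linear[OF vector_space_field])

lemma eval1_word: "eval1 v (word \<phi>s) = (if length \<phi>s = 1 then (\<phi>s ! 0) v else 0)"
  unfolding eval1_def by (rule vector_space.extend_linear_word[OF vector_space_field])

lemma eval2_word: "eval2 u v (word \<phi>s) = (if length \<phi>s = 2
    then (- 1) powi (hdeg V u * hdeg V v) * ((\<phi>s ! 0) u * (\<phi>s ! 1) v) + (\<phi>s ! 0) v * (\<phi>s ! 1) u else 0)"
  unfolding eval2_def by (rule vector_space.extend_linear_word[OF vector_space_field])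

lemmas eval1_linear = linear_functional[OF linear_eval1]
  and eval2_linear = linear_functional[OF linear_eval2]

text \<open>On one-letter words the coinvariant relations are trivial, the identity being the only
  permutation, and the multilinear ones hold by the pointwise operations on functionals.\<close>

lemma eval1_null:
  assumes "p \<in> dual.null"
  shows "eval1 v p = 0"
proof -
  have "eval1 v p \<in> {0}"
  proof (rule dual.null_induct[OF assms linear_eval1 subspace_zero_field], goal_cases multilinear coinvariant)
    case (multilinear xs ys \<phi> \<psi> i a b)
    show ?case
      by (cases xs; cases ys) (simp_all add: eval1_linear eval1_word)
  next
    case (coinvariant \<phi>s \<sigma>)
    show ?case
    proof (cases "length \<phi>s = 1")
      case True
      with coinvariant have "\<sigma> = id" by (simp add: lessThan_Suc)
      then show ?thesis by (simp add: koszul_id eval1_linear)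
    qed (simp add: eval1_linear eval1_word)
  qed
  then show ?thesis by simp
qed

lemma permutes_lessThan_2: "\<sigma> permutes {..<2::nat} \<longleftrightarrow> \<sigma> = id \<or> \<sigma> = transpose 0 (Suc 0)"
proof -
  have "{..<2::nat} = {0, Suc 0}" by auto
  then show ?thesis by (simp add: permutes_doubleton_iff)
qed

lemma permute_list_transpose: "permute_list (transpose 0 (Suc 0)) [a, b] = [b, a]"
  by (simp add: permute_list_def)

lemma length_2_conv: "length xs = 2 \<longleftrightarrow> (\<exists>a b. xs = [a, b])"
  by (auto simp: length_Suc_conv eval_nat_numeral)

text \<open>If one of the two products is nonzero, the degrees of \<phi> and \<psi> are the
  negatives of those of \<open>u\<close> and \<open>v\<close> in some order, so both Koszul signs
  agree; and a sign squares to 1.\<close>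

lemma eval2_swap:
  assumes "u \<in> homogeneous V" "v \<in> homogeneous V" "\<phi> \<in> homogeneous Vd" "\<psi> \<in> homogeneous Vd"
  shows "eval2 u v (word [\<phi>, \<psi>]) = (- 1) powi (hdeg Vd \<phi> * hdeg Vd \<psi>) * eval2 u v (word [\<psi>, \<phi>])"
proof -
  let ?s = "(- 1) powi (hdeg V u * hdeg V v) :: 'k"
  show ?thesis
  proof (cases "\<phi> u * \<psi> v = 0 \<and> \<phi> v * \<psi> u = 0")
    case True
    then show ?thesis by (auto simp: eval2_word)
  next
    case False
    then have "(- 1) powi (hdeg Vd \<phi> * hdeg Vd \<psi>) = ?s"
      using dual_hdeg assms by (auto simp: mult.commute)
    then show ?thesis
      by (simp add: eval2_word distrib_left mult.commute[of "\<psi> v" "\<phi> u"] mult.commute[of "\<psi> u" "\<phi> v"])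
  qed
qed

lemma eval2_null:
  assumes "u \<in> homogeneous V" "v \<in> homogeneous V" "p \<in> dual.null"
  shows "eval2 u v p = 0"
proof -
  have "eval2 u v p \<in> {0}"
  proof (rule dual.null_induct[OF assms(3) linear_eval2 subspace_zero_field], goal_cases multilinear coinvariant)
    case (multilinear xs ys \<phi> \<psi> i a b)
    let ?f = "\<lambda>w. eval2 u v (word (xs @ [w] @ ys))"
    consider "length xs + length ys \<noteq> 1" | x where "xs = [x]" "ys = []" | y where "xs = []" "ys = [y]"
      by (cases xs; cases ys) auto
    then have "?f (dual_scale a \<phi> + dual_scale b \<psi>) = a * ?f \<phi> + b * ?f \<psi>"
      by cases (auto simp: eval2_word algebra_simps)
    then show ?case by (simp only: eval2_linear) simp
  next
    case (coinvariant \<phi>s \<sigma>)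
    show ?case
    proof (cases "length \<phi>s = 2")
      case True
      then obtain \<phi> \<psi> where \<phi>s: "\<phi>s = [\<phi>, \<psi>]" by (auto simp: length_2_conv)
      from True coinvariant consider "\<sigma> = id" | "\<sigma> = transpose 0 (Suc 0)"
        by (auto simp: permutes_lessThan_2)
      then show ?thesis
      proof cases
        case 1
        then show ?thesis by (simp add: koszul_id eval2_linear)
      next
        case 2
        then show ?thesis
          using coinvariant assms eval2_swap[of u v \<phi> \<psi>]
          by (simp add: \<phi>s koszul_transpose permute_list_transpose eval2_linear)
      qed
    qed (simp add: eval2_linear eval2_word)
  qed
  then show ?thesis by simp
qed

lemma eval1_rep_cls: "eval1 v (rep (dual.cls p)) = eval1 v p"
  by (rule dual.linear_rep_cls[OF linear_eval1 eval1_null])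

lemma eval2_rep_cls:
  "\<lbrakk>u \<in> homogeneous V; v \<in> homogeneous V\<rbrakk> \<Longrightarrow> eval2 u v (rep (dual.cls p)) = eval2 u v p"
  by (rule dual.linear_rep_cls[OF linear_eval2 eval2_null])

lemma linear_eq_on_homogeneous_span:
  assumes "Vector_Spaces.linear fscale t f" "Vector_Spaces.linear fscale t g"
    and "\<And>\<phi>s. set \<phi>s \<subseteq> homogeneous Vd \<Longrightarrow> f (word \<phi>s) = g (word \<phi>s)"
    and "p \<in> dual.homogeneous_span"
  shows "f p = g p"
proof -
  interpret f: Vector_Spaces.linear fscale t f by fact
  interpret g: Vector_Spaces.linear fscale t g by fact
  show ?thesis
    using assms(4) unfolding dual.homogeneous_span_def
    by (induction rule: free_alg.span_induct_alt)
      (use assms(3) in \<open>auto simp: f.add f.scale g.add g.scale dual.homogeneous_words_iff\<close>)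
qed

lemma sym_functional_eq_extend_linear:
  assumes "vs \<in> words V n"
  shows "sym_functional scale V n A vs = extend_linear (*) (\<lambda>\<phi>s. if length \<phi>s = n
    then \<Sum>\<sigma> | \<sigma> permutes {..<n}. koszul \<sigma> (map (hdeg V) vs) * tensor_eval scale V \<phi>s (permute_list \<sigma> vs)
    else 0) (rep A)"
  using assms unfolding sym_functional_def extend_linear_def
  by (auto intro!: sum.mono_neutral_cong_left split: if_splits)

lemma sym_functional_1:
  assumes "A \<in> Sym dual_scale Vd" "v \<in> homogeneous V"
  shows "sym_functional scale V 1 A [v] = eval1 v (rep A)"
proof -
  have v: "[v] \<in> words V 1" using assms by (simp add: words_def)
  have perms: "{\<sigma>. \<sigma> permutes {..<1::nat}} = {id}" by (auto simp: lessThan_Suc)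
  have pairs: "{(i::nat, j::nat). i < j \<and> j = 0} = {}" by auto
  have "(if length \<phi>s = 1 then \<Sum>\<sigma> | \<sigma> permutes {..<1}.
        koszul \<sigma> (map (hdeg V) [v]) * tensor_eval scale V \<phi>s (permute_list \<sigma> [v]) else 0) =
      (if length \<phi>s = 1 then (\<phi>s ! 0) v else 0)" for \<phi>s
    unfolding perms by (simp add: koszul_id tensor_eval_def pairs)
  then show ?thesis
    unfolding sym_functional_eq_extend_linear[OF v] eval1_def by (simp only:)
qed

text \<open>Where \<psi> pairs nontrivially its degree is minus that of its argument. So the tensor
  sign of the identity becomes the sign in \<open>eval2\<close>, and that of the transposition
  cancels the Koszul sign. This needs homogeneous functionals, hence the reduction to
  \<open>homogeneous_span\<close>.\<close>

lemma sym_functional_2: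
  assumes "A \<in> Sym dual_scale Vd" and uv: "u \<in> homogeneous V" "v \<in> homogeneous V"
  shows "sym_functional scale V 2 A [u, v] = eval2 u v (rep A)"
proof -
  have w: "[u, v] \<in> words V 2" using assms by (simp add: words_def)
  have perms: "{\<sigma>. \<sigma> permutes {..<2::nat}} = {id, transpose 0 (Suc 0)}"
    by (auto simp: permutes_lessThan_2)
  have neq: "id \<noteq> transpose 0 (Suc 0)" by (metis id_apply n_not_Suc_n transpose_apply_first)
  have pairs: "{(i::nat, j). i < j \<and> j < Suc (Suc 0)} = {(0, 1)}" by auto
  have tensor: "tensor_eval scale V [\<phi>, \<psi>] [a, b] = (- 1) powi (hdeg Vd \<psi> * hdeg V a) * (\<phi> a * \<psi> b)"
    for \<phi> \<psi> a b
    by (simp add: tensor_eval_def pairs lessThan_Suc numeral_2_eq_2 mult_ac)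
  show ?thesis
    unfolding sym_functional_eq_extend_linear[OF w] eval2_def
  proof (rule linear_eq_on_homogeneous_span)
    show "rep A \<in> dual.homogeneous_span" by (rule dual.rep_homogeneous_span[OF assms(1)])
    fix \<phi>s assume hom: "set \<phi>s \<subseteq> homogeneous Vd"
    show "extend_linear (*) (\<lambda>\<phi>s. if length \<phi>s = 2
        then \<Sum>\<sigma> | \<sigma> permutes {..<2}. koszul \<sigma> (map (hdeg V) [u, v]) *
          tensor_eval scale V \<phi>s (permute_list \<sigma> [u, v]) else 0) (word \<phi>s) =
      extend_linear (*) (\<lambda>\<phi>s. if length \<phi>s = 2
        then (- 1) powi (hdeg V u * hdeg V v) * ((\<phi>s ! 0) u * (\<phi>s ! 1) v) + (\<phi>s ! 0) v * (\<phi>s ! 1) u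
        else 0) (word \<phi>s)"
    proof (cases "length \<phi>s = 2")
      case True
      then obtain \<phi> \<psi> where \<phi>s: "\<phi>s = [\<phi>, \<psi>]" by (auto simp: length_2_conv)
      with hom have h: "\<phi> \<in> homogeneous Vd" "\<psi> \<in> homogeneous Vd" by auto
      have 1: "(- 1) powi (hdeg Vd \<psi> * hdeg V u) * (\<phi> u * \<psi> v)
          = (- 1) powi (hdeg V u * hdeg V v) * (\<phi> u * \<psi> v)"
        using dual_hdeg[OF h(2) uv(2)]
        by (cases "\<psi> v = 0") (auto simp: mult.commute power_int_minus_one_minus)
      have 2: "(- 1) powi (hdeg V u * hdeg V v) * ((- 1) powi (hdeg Vd \<psi> * hdeg V v) * (\<phi> v * \<psi> u))
          = \<phi> v * \<psi> u"
        using dual_hdeg[OF h(2) uv(1)] by (cases "\<psi> u = 0") (auto simp: mult.commute power_int_minus_one_minus)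
      show ?thesis
        unfolding vector_space.extend_linear_word[OF vector_space_field] perms
        using neq by (simp add: \<phi>s koszul_id koszul_transpose permute_list_transpose tensor 1 2)
    qed (simp add: vector_space.extend_linear_word[OF vector_space_field])
  qed (rule vector_space.linear_extend_linear[OF vector_space_field])+
qed

end


section \<open>Dual bases and the dual brackets\<close>

text \<open>Finite support and finite-dimensional components give one finite dual basis for the
  entire complex. The lower bound makes 1 the top degree of the dual, and characteristic zero
  permits the division by 2 in \<open>l_dual_2\<close>.\<close>

locale finite_Linf1_algebra = Linf1_algebra scale F d l
  for scale :: "'k::field_char_0 \<Rightarrow> 'v::ab_group_add \<Rightarrow> 'v" and F :: "int \<Rightarrow> 'v set"
    and d :: "'v \<Rightarrow> 'v" and l :: "nat \<Rightarrow> ('v, 'k) sym \<Rightarrow> 'v" +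
  assumes bounded_below: "i < - 1 \<Longrightarrow> F i = {0}"
    and finite_support: "finite {i. F i \<noteq> {0}}"
    and finite_dimensional: "\<exists>B. finite B \<and> span B = F i"
begin

abbreviation bracket2 :: "'v \<Rightarrow> 'v \<Rightarrow> 'v"
  where "bracket2 u v \<equiv> l 2 (monomial scale F [u, v])"

text \<open>Bases of the finitely many nonzero components, each vector paired with its degree. A
  coordinate functional is composed with the projection to that degree, which puts it into the dual
  grading.\<close>

lemma dual_basis:
  obtains X :: "(int \<times> 'v) set" and \<gamma> :: "int \<times> 'v \<Rightarrow> 'v \<Rightarrow> 'k"
  where "finite X" "\<And>x. x \<in> X \<Longrightarrow> snd x \<in> F (fst x)" "\<And>x. x \<in> X \<Longrightarrow> \<gamma> x \<in> Vd (- fst x)"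
    "\<And>i v. v \<in> F i \<Longrightarrow> v = (\<Sum>x | x \<in> X \<and> fst x = i. scale (\<gamma> x v) (snd x))"
proof -
  have "\<exists>B. finite B \<and> independent B \<and> span B = F i" for i
  proof -
    obtain B where B: "finite B" "span B = F i" using finite_dimensional by blast
    obtain B' where "B' \<subseteq> B" "independent B'" "B \<subseteq> span B'"
      by (rule maximal_independent_subset)
    with B show ?thesis
      by (intro exI[of _ B']) (metis finite_subset span_minimal span_mono subset_antisym subspace_span)
  qed
  then obtain B where B: "finite (B i)" "independent (B i)" "span (B i) = F i" for i by metis
  define X where "X = Sigma {i. F i \<noteq> {0}} B"
  define \<gamma> where "\<gamma> x v = representation (B (fst x)) (component v (fst x)) (snd x)" for x v
  have mem: "component v i \<in> span (B i)" for v i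
    using component_props(1) B(3) by simp
  show thesis
  proof
    show "finite X" unfolding X_def using finite_support B(1) by blast
    show "snd x \<in> F (fst x)" if "x \<in> X" for x
      using that B(3) span_base by (fastforce simp: X_def)
    show "\<gamma> x \<in> Vd (- fst x)" if "x \<in> X" for x
    proof -
      have "component (u + v) = (\<lambda>i. component u i + component v i)" for u v
        using component_comb[of 1 u 1 v] by simp
      moreover have "component (scale c v) = (\<lambda>i. scale c (component v i))" for c v
        using component_comb[of c v 0 v] by simp
      ultimately have "Vector_Spaces.linear scale (*) (\<gamma> x)"
        by (intro linear_functionalI[OF vector_space_axioms])
          (simp_all add: \<gamma>_def representation_add[OF B(2) mem mem] representation_scale[OF B(2) mem])
      then show ?thesis
        by (auto simp: dual_grading_def \<gamma>_def component_of_mem representation_zero)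
    qed
    fix i v assume v: "v \<in> F i"
    show "v = (\<Sum>x | x \<in> X \<and> fst x = i. scale (\<gamma> x v) (snd x))"
    proof (cases "F i = {0}")
      case True
      then have "{x. x \<in> X \<and> fst x = i} = {}" by (auto simp: X_def)
      then show ?thesis using v True by (metis singletonD sum.empty)
    next
      case False
      then have "{x. x \<in> X \<and> fst x = i} = Pair i ` B i" by (auto simp: X_def)
      then have "(\<Sum>x | x \<in> X \<and> fst x = i. scale (\<gamma> x v) (snd x)) =
          (\<Sum>b\<in>B i. scale (representation (B i) v b) b)"
        by (simp add: sum.reindex inj_on_def \<gamma>_def component_of_mem[OF v])
      also have "\<dots> = v"
        using B v by (intro sum_representation_eq) auto
      finally show ?thesis ..
    qed
  qed
qed

text \<open>Otherwise every coordinate of \<open>v\<close> in the dual basis would vanish, and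
  \<open>v\<close> with them.\<close>

lemma exists_dual_nonzero:
  assumes "v \<in> F i" "v \<noteq> 0"
  obtains \<phi> where "\<phi> \<in> Vd (- i)" "\<phi> v \<noteq> 0"
proof -
  obtain X \<gamma> where "finite X" "\<And>x. x \<in> X \<Longrightarrow> snd x \<in> F (fst x)"
    and X: "\<And>x. x \<in> X \<Longrightarrow> \<gamma> x \<in> Vd (- fst x)"
    "\<And>i v. v \<in> F i \<Longrightarrow> v = (\<Sum>x | x \<in> X \<and> fst x = i. scale (\<gamma> x v) (snd x))"
    by (rule dual_basis) blast
  have "\<exists>x\<in>X. fst x = i \<and> \<gamma> x v \<noteq> 0"
  proof (rule ccontr)
    assume "\<not> (\<exists>x\<in>X. fst x = i \<and> \<gamma> x v \<noteq> 0)"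
    then have "(\<Sum>x | x \<in> X \<and> fst x = i. scale (\<gamma> x v) (snd x)) = 0"
      by (intro sum.neutral) auto
    with X(2)[OF assms(1)] assms(2) show False by simp
  qed
  with X(1) that show thesis by blast
qed

lemma dual_support:
  assumes "\<phi> \<in> Vd j" "j \<notin> uminus ` {i. F i \<noteq> {0}}"
  shows "\<phi> = 0"
proof (rule dual_eq_0[OF assms(1)])
  fix v assume "v \<in> F (- j)"
  moreover have "F (- j) = {0}" using assms(2) by (metis (mono_tags) image_eqI mem_Collect_eq minus_minus)
  ultimately show "\<phi> v = 0" using linear_functional(4)[OF dual_linear[OF assms(1)]] by simp
qed

lemma dual_2_trivial: "\<phi> \<in> Vd 2 \<Longrightarrow> \<phi> = 0"
  by (erule dual_support) (use bounded_below in fastforce)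

text \<open>Modulo the relations, a linear combination of one-letter words is a sum of one letter in each
  degree.\<close>

lemma null_if_eval1_zero:
  assumes p: "p \<in> free_alg.span (word ` words Vd 1)" and zero: "\<And>v. v \<in> homogeneous F \<Longrightarrow> eval1 v p = 0"
  shows "p \<in> dual.null"
proof -
  let ?J = "uminus ` {i. F i \<noteq> {0}}"
  have fin: "finite ?J" using finite_support by simp
  \<comment> \<open>The multilinear relations merge only letters of equal degree, so the letters of
    different degrees stay apart.\<close>
  have "\<exists>f. (\<forall>j. f j \<in> Vd j) \<and> p - (\<Sum>j\<in>?J. word [f j]) \<in> dual.null"
    using p
  proof (induction rule: free_alg.span_induct_alt)
    case base
    have "- (\<Sum>j\<in>?J. word [0]) \<in> dual.null"
      by (intro dual.null_uminus dual.null_sum dual.null_zero_letter) auto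
    then show ?case
      by (intro exI[of _ "\<lambda>_. 0"] conjI allI zero_mem_dual) (simp only: diff_0)
  next
    case (step c x p)
    then obtain f where f: "\<And>j. f j \<in> Vd j" "p - (\<Sum>j\<in>?J. word [f j]) \<in> dual.null" by blast
    from step obtain \<phi> i where \<phi>: "x = word [\<phi>]" "\<phi> \<in> Vd i"
      by (auto simp: words_def length_Suc_conv homogeneous_def)
    show ?case
    proof (cases "i \<in> ?J")
      case True
      define \<psi> where "\<psi> = dual_scale c \<phi> + dual_scale 1 (f i)"
      define h where "h = f(i := \<psi>)"
      have "word [\<psi>] - fscale c (word [\<phi>]) - fscale 1 (word [f i]) \<in> dual.null"
        using dual.null_multilinear[of "[]" "[]" \<phi> i "f i" c 1] \<phi> f(1) by (simp add: \<psi>_def)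
      from dual.null_diff[OF f(2) this]
      have "p - (\<Sum>j\<in>?J. word [f j]) + word [f i] + fscale c x - word [\<psi>] \<in> dual.null"
        using \<phi> by (simp add: algebra_simps)
      moreover have "fscale c x + p - (\<Sum>j\<in>?J. word [h j]) =
          p - (\<Sum>j\<in>?J. word [f j]) + word [f i] + fscale c x - word [\<psi>]"
        by (simp add: sum.remove[OF fin True] h_def)
      moreover have "\<forall>j. h j \<in> Vd j"
        using f(1) dual_comb[OF \<phi>(2) f(1), where a = c and b = 1] by (simp add: h_def \<psi>_def)
      ultimately show ?thesis
        by (intro exI[of _ h]) (simp only: simp_thms)
    next
      case False
      then have "\<phi> = 0" using dual_support[OF \<phi>(2)] by blast
      then have "fscale c x \<in> dual.null"
        using \<phi> by (intro dual.null_scale) (simp add: dual.null_zero_letter)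
      from dual.null_add[OF this f(2)] show ?thesis
        using f(1) by (intro exI[of _ f]) (simp add: algebra_simps del: dual_scale_apply)
    qed
  qed
  then obtain f where f: "\<And>j. f j \<in> Vd j" "p - (\<Sum>j\<in>?J. word [f j]) \<in> dual.null" by blast
  have eval: "eval1 v p = (\<Sum>j\<in>?J. f j v)" for v
    using eval1_null[OF f(2), of v] by (simp add: eval1_linear eval1_word)
  have "f j = 0" if j: "j \<in> ?J" for j
  proof (rule dual_eq_0[OF f(1)])
    \<comment> \<open>A vector of degree \<open>- j\<close> is seen by no letter but
      \<open>f j\<close>.\<close>
    fix v assume v: "v \<in> F (- j)"
    have "eval1 v p = f j v + (\<Sum>j\<in>?J - {j}. f j v)"
      unfolding eval by (rule sum.remove[OF fin j])
    also have "(\<Sum>j\<in>?J - {j}. f j v) = 0"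
      using dual_vanish[OF f(1) v] by (intro sum.neutral) auto
    finally show "f j v = 0" using zero[OF homogeneousI[OF v]] by simp
  qed
  then have "(\<Sum>j\<in>?J. word [f j]) \<in> dual.null"
    by (intro dual.null_sum) (simp add: dual.null_zero_letter)
  from dual.null_add[OF f(2) this] show ?thesis by simp
qed

lemma word_mem_Sym_pow: "set \<phi>s \<subseteq> homogeneous Vd \<Longrightarrow> monomial dual_scale Vd \<phi>s \<in> Sym_pow dual_scale Vd (length \<phi>s)"
  unfolding Sym_pow_def by (intro imageI free_alg.span_base) (simp add: words_def)

text \<open>\<open>l_dual\<close> returns some preimage under \<open>sym_functional\<close>;
  injectivity is what identifies it in \<open>l_dual_1\<close>.\<close>

lemma inj_on_sym_functional_1: "inj_on (sym_functional scale F 1) (Sym_pow dual_scale Vd 1)"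
proof (rule inj_onI)
  fix A B assume A: "A \<in> Sym_pow dual_scale Vd 1" and B: "B \<in> Sym_pow dual_scale Vd 1"
    and eq: "sym_functional scale F 1 A = sym_functional scale F 1 B"
  obtain p q where p: "A = dual.cls p" "p \<in> free_alg.span (word ` words Vd 1)"
    and q: "B = dual.cls q" "q \<in> free_alg.span (word ` words Vd 1)"
    using A B unfolding Sym_pow_def by blast
  have "p - q \<in> dual.null"
  proof (rule null_if_eval1_zero)
    show "p - q \<in> free_alg.span (word ` words Vd 1)" by (rule free_alg.span_diff[OF p(2) q(2)])
    fix v assume "v \<in> homogeneous F"
    moreover have "A \<in> Sym dual_scale Vd" "B \<in> Sym dual_scale Vd"
      using A B dual.Sym_pow_subset by blast+
    ultimately have "eval1 v (rep A) = eval1 v (rep B)"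
      using sym_functional_1[of A v] sym_functional_1[of B v] unfolding eq by (simp only:)
    then show "eval1 v (p - q) = 0"
      by (simp add: p q eval1_rep_cls eval1_linear)
  qed
  then show "A = B" by (simp add: p q dual.cls_eq_iff)
qed

section \<open>The differential of the dual complex\<close>

definition d_dual :: "('v \<Rightarrow> 'k) \<Rightarrow> 'v \<Rightarrow> 'k"
  where "d_dual \<phi> = dual_scale (- ((- 1) powi hdeg Vd \<phi>)) (\<phi> \<circ> d)"

text \<open>For \<open>\<phi> = 0\<close> both sides vanish, whatever \<open>hdeg\<close> is. With
  one fixed sign per degree the map is linear within that degree, even where a combination is
  zero.\<close>

lemma d_dual_eq: "\<phi> \<in> Vd i \<Longrightarrow> d_dual \<phi> = dual_scale (- ((- 1) powi i)) (\<phi> \<circ> d)"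
  by (cases "\<phi> = 0") (auto simp: d_dual_def dual.hdeg_eq fun_eq_iff)

lemma d_dual_degree:
  assumes "\<phi> \<in> Vd i"
  shows "d_dual \<phi> \<in> Vd (i + 1)"
proof -
  interpret d: Vector_Spaces.linear scale scale d by (rule d_linear)
  note \<phi> = linear_functional[OF dual_linear[OF assms]]
  have "Vector_Spaces.linear scale (*) (d_dual \<phi>)"
    by (rule linear_functionalI[OF vector_space_axioms])
      (simp_all add: d_dual_def \<phi> d.add d.scale algebra_simps)
  moreover have "d_dual \<phi> v = 0" if "v \<in> F j" "j \<noteq> - (i + 1)" for v j
    using dual_vanish[OF assms d_degree[OF that(1)]] that(2) by (simp add: d_dual_def)
  ultimately show ?thesis by (simp add: dual_grading_def)
qed

lemma l_dual_1:
  assumes "\<phi> \<in> homogeneous Vd"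
  shows "l_dual scale F l 1 \<phi> = monomial dual_scale Vd [d_dual \<phi>]"
proof -
  obtain i where i: "\<phi> \<in> Vd i" using assms by (auto simp: homogeneous_def)
  have mem: "monomial dual_scale Vd [d_dual \<phi>] \<in> Sym_pow dual_scale Vd 1"
    using word_mem_Sym_pow[of "[d_dual \<phi>]"] d_dual_degree[OF i] dual.homogeneousI by simp
  have "sym_functional scale F 1 (monomial dual_scale Vd [d_dual \<phi>]) =
    (\<lambda>vs\<in>words F 1. - ((- 1) powi hdeg Vd \<phi>) * \<phi> (l 1 (monomial scale F vs)))"
  proof
    fix vs
    show "sym_functional scale F 1 (monomial dual_scale Vd [d_dual \<phi>]) vs =
      (\<lambda>vs\<in>words F 1. - ((- 1) powi hdeg Vd \<phi>) * \<phi> (l 1 (monomial scale F vs))) vs"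
    proof (cases "vs \<in> words F 1")
      case True
      then obtain v where v: "vs = [v]" "v \<in> homogeneous F"
        by (auto simp: words_def length_Suc_conv)
      have "sym_functional scale F 1 (monomial dual_scale Vd [d_dual \<phi>]) vs = d_dual \<phi> v"
        unfolding v using mem dual.Sym_pow_subset
        by (subst sym_functional_1) (auto simp: v eval1_rep_cls eval1_word)
      with True v l_1[OF v(2)] show ?thesis
        by (simp add: d_dual_def)
    qed (simp add: sym_functional_def)
  qed
  then show ?thesis
    unfolding l_dual_def by (metis inv_into_f_f inj_on_sym_functional_1 mem)
qed

sublocale d_dual: degree_one_map dual_scale Vd d_dual "l_dual scale F l 1"
proof
  show "d_dual \<phi> \<in> Vd (i + 1)" if "\<phi> \<in> Vd i" for \<phi> i
    by (rule d_dual_degree[OF that])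
  show "d_dual (dual_scale a \<phi> + dual_scale b \<psi>) = dual_scale a (d_dual \<phi>) + dual_scale b (d_dual \<psi>)"
    if "\<phi> \<in> Vd i" "\<psi> \<in> Vd i" for \<phi> \<psi> i a b
    using that by (simp add: d_dual_eq[of _ i] dual_comb fun_eq_iff algebra_simps)
  show "l_dual scale F l 1 \<phi> = monomial dual_scale Vd [d_dual \<phi>]" if "\<phi> \<in> homogeneous Vd" for \<phi>
    by (rule l_dual_1[OF that])
qed

section \<open>The binary bracket as a graded symmetric bilinear operation\<close>

lemma l_span_add:
  assumes "n \<ge> 1" "p \<in> free_alg.span (word ` words F n)" "q \<in> free_alg.span (word ` words F n)"
  shows "l n (cls (p + q)) = l n (cls p) + l n (cls q)"
proof -
  have "cls p \<in> Sym_pow scale F n" "cls q \<in> Sym_pow scale F n"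
    using assms by (auto simp: Sym_pow_def)
  from l_add[OF assms(1) this] show ?thesis by (simp add: sym_add_cls)
qed

lemma l_span_scale:
  assumes "n \<ge> 1" "p \<in> free_alg.span (word ` words F n)"
  shows "l n (cls (fscale c p)) = scale c (l n (cls p))"
proof -
  have "cls p \<in> Sym_pow scale F n"
    using assms by (auto simp: Sym_pow_def)
  from l_scale[OF assms(1) this] show ?thesis by (simp add: sym_scale_cls)
qed

lemma word2_span:
  "\<lbrakk>u \<in> homogeneous F; v \<in> homogeneous F\<rbrakk> \<Longrightarrow> word [u, v] \<in> free_alg.span (word ` words F 2)"
  by (intro free_alg.span_base imageI) (simp add: words_def)

lemma bracket2_comb_left:
  assumes "u \<in> F i" "w \<in> F i" "v \<in> homogeneous F"
  shows "bracket2 (scale a u + scale b w) v = scale a (bracket2 u v) + scale b (bracket2 w v)"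
proof -
  have "cls (word [scale a u + scale b w, v]) = cls (fscale a (word [u, v]) + fscale b (word [w, v]))"
    unfolding cls_eq_iff using null_multilinear[of "[]" "[v]" u i w a b] assms by (simp add: algebra_simps)
  then show ?thesis
    using assms by (simp add: l_span_add l_span_scale word2_span free_alg.span_scale homogeneousI)
qed

lemma bracket2_comb_right:
  assumes "u \<in> F i" "w \<in> F i" "v \<in> homogeneous F"
  shows "bracket2 v (scale a u + scale b w) = scale a (bracket2 v u) + scale b (bracket2 v w)"
proof -
  have "cls (word [v, scale a u + scale b w]) = cls (fscale a (word [v, u]) + fscale b (word [v, w]))"
    unfolding cls_eq_iff using null_multilinear[of "[v]" "[]" u i w a b] assms by (simp add: algebra_simps)
  then show ?thesis
    using assms by (simp add: l_span_add l_span_scale word2_span free_alg.span_scale homogeneousI)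
qed

lemma bracket2_commute:
  assumes "u \<in> homogeneous F" "v \<in> homogeneous F"
  shows "bracket2 u v = scale ((- 1) powi (hdeg F u * hdeg F v)) (bracket2 v u)"
proof -
  have "transpose 0 (Suc 0) permutes {..<length [u, v]}"
    using permutes_lessThan_2 by (simp add: numeral_2_eq_2)
  then have "cls (word [u, v]) = cls (fscale ((- 1) powi (hdeg F u * hdeg F v)) (word [v, u]))"
    unfolding cls_eq_iff using null_coinvariant[of "[u, v]" "transpose 0 (Suc 0)"] assms
    by (simp add: koszul_transpose permute_list_transpose)
  then show ?thesis
    using assms by (simp add: l_span_scale word2_span)
qed

lemma bracket2_zero_left: "v \<in> homogeneous F \<Longrightarrow> bracket2 0 v = 0"
  using bracket2_comb_left[of 0 0 0 v 0 0] by simp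

lemma bracket2_zero_right: "v \<in> homogeneous F \<Longrightarrow> bracket2 v 0 = 0"
  using bracket2_comb_right[of 0 0 0 v 0 0] by simp

lemma sum_component: "(\<And>x. x \<in> S \<Longrightarrow> e x \<in> F i) \<Longrightarrow> (\<Sum>x\<in>S. scale (c x) (e x)) \<in> F i"
  by (intro subspace_sum[OF subspace_V] subspace_scale[OF subspace_V])

lemma bracket2_sum_left:
  assumes "finite S" "\<And>x. x \<in> S \<Longrightarrow> e x \<in> F i" "v \<in> homogeneous F"
  shows "bracket2 (\<Sum>x\<in>S. scale (c x) (e x)) v = (\<Sum>x\<in>S. scale (c x) (bracket2 (e x) v))"
  using assms(1,2)
proof (induction S rule: finite_induct)
  case (insert x S)
  then show ?case
    using bracket2_comb_left[OF _ sum_component[of S e i c] assms(3), of "e x" "c x" 1] by simp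
qed (simp add: bracket2_zero_left assms)

lemma bracket2_sum_right:
  assumes "finite S" "\<And>x. x \<in> S \<Longrightarrow> e x \<in> F i" "v \<in> homogeneous F"
  shows "bracket2 v (\<Sum>x\<in>S. scale (c x) (e x)) = (\<Sum>x\<in>S. scale (c x) (bracket2 v (e x)))"
  using assms(1,2)
proof (induction S rule: finite_induct)
  case (insert x S)
  then show ?case
    using bracket2_comb_right[OF _ sum_component[of S e i c] assms(3), of "e x" "c x" 1] by simp
qed (simp add: bracket2_zero_right assms)

text \<open>\<alpha> composed with the bracket must lie in the image of
  \<open>sym_functional\<close>, since \<open>inv_into\<close> is meaningful only there. Expanding
  the bracket in a dual basis gives a preimage. Whichever preimage \<open>l_dual\<close> picks, its
  pairing with \<open>u\<close> and \<open>v\<close> is prescribed.\<close>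

lemma l_dual_2:
  assumes \<alpha>: "\<alpha> \<in> homogeneous Vd"
  shows "l_dual scale F l 2 \<alpha> \<in> Sym_pow dual_scale Vd 2"
    and "\<lbrakk>u \<in> homogeneous F; v \<in> homogeneous F\<rbrakk> \<Longrightarrow>
      eval2 u v (rep (l_dual scale F l 2 \<alpha>)) = - ((- 1) powi hdeg Vd \<alpha>) * \<alpha> (bracket2 u v)"
proof -
  define c :: 'k where "c = - ((- 1) powi hdeg Vd \<alpha>)"
  note lin = linear_functional[OF dual_linear[OF dual.hdeg_mem[OF \<alpha>]]]
  obtain X \<gamma> where X: "finite X" "\<And>x. x \<in> X \<Longrightarrow> snd x \<in> F (fst x)" "\<And>x. x \<in> X \<Longrightarrow> \<gamma> x \<in> Vd (- fst x)"
    "\<And>i v. v \<in> F i \<Longrightarrow> v = (\<Sum>x | x \<in> X \<and> fst x = i. scale (\<gamma> x v) (snd x))"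
    by (rule dual_basis) blast
  \<comment> \<open>The sign undoes the one in the first summand of \<open>eval2\<close>; in the
    second summand it supplies the sign of graded symmetry.\<close>
  let ?e = "\<lambda>x y. (- 1) powi (fst x * fst y) * \<alpha> (bracket2 (snd x) (snd y))"
  \<comment> \<open>Only basis vectors of the degrees of \<open>u\<close> and \<open>v\<close>
    contribute, which makes the sign constant; bilinearity then reassembles \<open>u\<close> and
    \<open>v\<close>.\<close>
  have expand: "(\<Sum>x\<in>X. \<Sum>y\<in>X. ?e x y * (\<gamma> x u * \<gamma> y v)) = (- 1) powi (i * j) * \<alpha> (bracket2 u v)"
    if uv: "u \<in> F i" "v \<in> F j" for u v i j
  proof -
    let ?X = "\<lambda>i. {x. x \<in> X \<and> fst x = i}"
    have "(\<Sum>x\<in>X. \<Sum>y\<in>X. ?e x y * (\<gamma> x u * \<gamma> y v)) = (\<Sum>x\<in>?X i. \<Sum>y\<in>X. ?e x y * (\<gamma> x u * \<gamma> y v))"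
      by (intro sum.mono_neutral_right ballI sum.neutral) (use X(1) dual_vanish[OF X(3) uv(1)] in auto)
    also have "\<dots> = (\<Sum>x\<in>?X i. \<Sum>y\<in>?X j. ?e x y * (\<gamma> x u * \<gamma> y v))"
      by (intro sum.cong refl sum.mono_neutral_right ballI) (use X(1) dual_vanish[OF X(3) uv(2)] in auto)
    also have "\<dots> = (- 1) powi (i * j) * (\<Sum>x\<in>?X i. \<gamma> x u * (\<Sum>y\<in>?X j. \<gamma> y v * \<alpha> (bracket2 (snd x) (snd y))))"
      by (simp add: sum_distrib_left mult_ac)
    also have "(\<Sum>x\<in>?X i. \<gamma> x u * (\<Sum>y\<in>?X j. \<gamma> y v * \<alpha> (bracket2 (snd x) (snd y)))) =
        (\<Sum>x\<in>?X i. \<gamma> x u * \<alpha> (bracket2 (snd x) v))"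
    proof (intro sum.cong refl arg_cong2[of _ _ _ _ "(*)"])
      fix x assume x: "x \<in> ?X i"
      have "bracket2 (snd x) v = (\<Sum>y\<in>?X j. scale (\<gamma> y v) (bracket2 (snd x) (snd y)))"
        using X(1,2) x by (subst X(4)[OF uv(2)], intro bracket2_sum_right[of _ _ j]) (auto intro: homogeneousI[OF X(2)])
      then show "(\<Sum>y\<in>?X j. \<gamma> y v * \<alpha> (bracket2 (snd x) (snd y))) = \<alpha> (bracket2 (snd x) v)"
        by (simp add: lin)
    qed
    also have "\<dots> = \<alpha> (bracket2 u v)"
    proof -
      have "bracket2 u v = (\<Sum>x\<in>?X i. scale (\<gamma> x u) (bracket2 (snd x) v))"
        using X(1,2) uv by (subst X(4)[OF uv(1)], intro bracket2_sum_left[of _ _ i]) (auto intro: homogeneousI)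
      then show ?thesis by (simp add: lin)
    qed
    finally show ?thesis .
  qed
  \<comment> \<open>The division by 2 is due to the two permutations in
    \<open>sym_functional\<close>, which contribute the same value.\<close>
  define P where "P = (\<Sum>x\<in>X. \<Sum>y\<in>X. fscale (c / 2 * ?e x y) (word [\<gamma> x, \<gamma> y]))"
  have "P \<in> free_alg.span (word ` words Vd 2)"
    unfolding P_def
    by (intro free_alg.span_sum free_alg.span_scale free_alg.span_base imageI)
      (auto simp: words_def intro: dual.homogeneousI X(3))
  then have P: "dual.cls P \<in> Sym_pow dual_scale Vd 2"
    unfolding Sym_pow_def by (rule imageI)
  have eval_P: "eval2 u v P = c * \<alpha> (bracket2 u v)" if uv: "u \<in> homogeneous F" "v \<in> homogeneous F" for u v
  proof -
    let ?s = "(- 1) powi (hdeg F u * hdeg F v) :: 'k"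
    note mem = hdeg_mem[OF uv(1)] hdeg_mem[OF uv(2)]
    have "eval2 u v P = (\<Sum>x\<in>X. \<Sum>y\<in>X. c / 2 * ?e x y * (?s * (\<gamma> x u * \<gamma> y v) + \<gamma> x v * \<gamma> y u))"
      by (simp add: P_def eval2_linear eval2_word)
    also have "\<dots> = c / 2 * (?s * (\<Sum>x\<in>X. \<Sum>y\<in>X. ?e x y * (\<gamma> x u * \<gamma> y v))
        + (\<Sum>x\<in>X. \<Sum>y\<in>X. ?e x y * (\<gamma> x v * \<gamma> y u)))"
      by (simp add: sum_distrib_left sum.distrib distrib_left add_divide_distrib mult_ac)
    also have "\<dots> = c / 2 * (?s * (?s * \<alpha> (bracket2 u v)) + ?s * \<alpha> (bracket2 v u))"
      unfolding expand[OF mem] expand[OF mem(2,1)] by (simp add: mult.commute)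
    also have "?s * \<alpha> (bracket2 v u) = \<alpha> (bracket2 u v)"
      by (subst bracket2_commute[OF uv]) (simp add: lin)
    finally show ?thesis by simp
  qed
  have "sym_functional scale F 2 (dual.cls P) = (\<lambda>vs\<in>words F 2. c * \<alpha> (l 2 (monomial scale F vs)))"
  proof
    fix vs
    show "sym_functional scale F 2 (dual.cls P) vs = (\<lambda>vs\<in>words F 2. c * \<alpha> (l 2 (monomial scale F vs))) vs"
    proof (cases "vs \<in> words F 2")
      case True
      then obtain u v where uv: "vs = [u, v]" "u \<in> homogeneous F" "v \<in> homogeneous F"
        by (auto simp: words_def length_2_conv)
      have "sym_functional scale F 2 (dual.cls P) vs = c * \<alpha> (bracket2 u v)"
        unfolding uv using P dual.Sym_pow_subset uv
        by (subst sym_functional_2) (auto simp: eval2_rep_cls eval_P)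
      with True uv show ?thesis by simp
    qed (simp add: sym_functional_def)
  qed
  then have img: "(\<lambda>vs\<in>words F 2. c * \<alpha> (l 2 (monomial scale F vs))) \<in>
      sym_functional scale F 2 ` Sym_pow dual_scale Vd 2"
    using P by (metis imageI)
  show mem: "l_dual scale F l 2 \<alpha> \<in> Sym_pow dual_scale Vd 2"
    unfolding l_dual_def c_def[symmetric] by (rule inv_into_into[OF img])
  assume uv: "u \<in> homogeneous F" "v \<in> homogeneous F"
  have "sym_functional scale F 2 (l_dual scale F l 2 \<alpha>) = (\<lambda>vs\<in>words F 2. c * \<alpha> (l 2 (monomial scale F vs)))"
    unfolding l_dual_def c_def[symmetric] by (rule f_inv_into_f[OF img])
  moreover have "sym_functional scale F 2 (l_dual scale F l 2 \<alpha>) [u, v] = eval2 u v (rep (l_dual scale F l 2 \<alpha>))"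
    using mem dual.Sym_pow_subset uv by (intro sym_functional_2) auto
  moreover have "[u, v] \<in> words F 2" using uv by (simp add: words_def)
  ultimately show "eval2 u v (rep (l_dual scale F l 2 \<alpha>)) = - ((- 1) powi hdeg Vd \<alpha>) * \<alpha> (bracket2 u v)"
    by (simp add: c_def)
qed

end


section \<open>Moller maps\<close>

context finite_Linf1_algebra
begin

lemma bracket2_degree:
  assumes "x \<in> F (- 1)" "y \<in> F (- 1)"
  shows "bracket2 x y \<in> F (- 1)"
\<comment> \<open>\<open>Sym_deg\<close> measures words by \<open>hdeg\<close>, which is known to be
  -1 only for nonzero letters.\<close>
proof (cases "x = 0 \<or> y = 0")
  case True
  then show ?thesis
    using assms by (auto simp: bracket2_zero_left bracket2_zero_right homogeneousI)
next
  case False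
  then have deg: "hdeg F x = - 1" "hdeg F y = - 1" using assms hdeg_eq by auto
  have hom: "set [x, y] \<subseteq> homogeneous F" using assms by (auto intro: homogeneousI)
  have "monomial scale F [x, y] \<in> Sym_pow scale F 2"
    unfolding Sym_pow_def by (intro imageI word2_span) (use hom in auto)
  moreover have "monomial scale F [x, y] \<in> Sym_deg scale F (- 2)"
    unfolding Sym_deg_def using hom deg
    by (intro imageI free_alg.span_base) (auto simp: words_def)
  ultimately show ?thesis using l_degree[of 2 "monomial scale F [x, y]" "- 2"] by simp
qed

lemma wedge2_nonvanishing:
  assumes "A \<in> wedge2_H scale F d" "l 2 A \<noteq> 0"
  obtains x y where "x \<in> H_minus_1 F d" "y \<in> H_minus_1 F d" "bracket2 x y \<noteq> 0"
proof (rule ccontr)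
  assume "\<not> thesis"
  with that have zero: "\<And>x y. \<lbrakk>x \<in> H_minus_1 F d; y \<in> H_minus_1 F d\<rbrakk> \<Longrightarrow> bracket2 x y = 0"
    by blast
  obtain p where p: "A = cls p"
    "p \<in> free_alg.span {word [x, y] | x y. x \<in> H_minus_1 F d \<and> y \<in> H_minus_1 F d}"
    using assms(1) unfolding wedge2_H_def by blast
  \<comment> \<open>Membership in the span is carried along, since additivity of \<open>l 2\<close>
    is available only on \<open>Sym_pow\<close>.\<close>
  from p(2) have "p \<in> free_alg.span (word ` words F 2) \<and> l 2 (cls p) = 0"
  proof (induction rule: free_alg.span_induct_alt)
    case base
    have "l 2 (cls (fscale 0 0)) = scale 0 (l 2 (cls 0))"
      by (intro l_span_scale free_alg.span_zero) simp
    then show ?case by (simp add: free_alg.span_zero)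
  next
    case (step c q p)
    then obtain x y where xy: "q = word [x, y]" "x \<in> H_minus_1 F d" "y \<in> H_minus_1 F d" by blast
    then have "q \<in> free_alg.span (word ` words F 2)"
      by (auto simp: H_minus_1_def intro: word2_span homogeneousI)
    then show ?case
      using step xy zero
      by (simp add: l_span_add l_span_scale free_alg.span_add free_alg.span_scale)
  qed
  with assms(2) p(1) show False by simp
qed

section \<open>Pairing with two cocycles of degree -1\<close>

context
  fixes x y
  assumes x: "x \<in> H_minus_1 F d" and y: "y \<in> H_minus_1 F d"
begin

lemma homogeneous_xy: "x \<in> homogeneous F" "y \<in> homogeneous F"
  using x y by (auto simp: H_minus_1_def intro: homogeneousI)

text \<open>Each word of the Leibniz sum contains a letter \<open>d_dual \<phi>\<close>. In a
  two-letter word both summands of \<open>eval2\<close> evaluate this letter on \<open>x\<close> or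
  on \<open>y\<close>, where it is zero.\<close>

lemma eval2_cocycles_delta_0:
  assumes "p \<in> dual.homogeneous_span"
  shows "eval2 x y (free_derivation Vd (l_dual scale F l 1) p) = 0"
proof -
  interpret D: Vector_Spaces.linear fscale fscale "free_derivation Vd (l_dual scale F l 1)"
    by (rule linear_free_derivation)
  have "p \<in> free_alg.span (word ` dual.homogeneous_words)"
    using assms by (simp add: dual.homogeneous_span_def)
  then show ?thesis
  proof (induction rule: free_alg.span_induct_alt)
    case (step c q p)
    then obtain vs where vs: "q = word vs" "set vs \<subseteq> homogeneous Vd"
      by (auto simp: dual.homogeneous_words_iff)
    let ?ds = "map (hdeg Vd) vs"
    have vanish: "d_dual \<phi> x = 0" "d_dual \<phi> y = 0" if "\<phi> \<in> homogeneous Vd" for \<phi>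
    proof -
      have "\<phi> 0 = 0"
        by (rule linear_functional(4)[OF dual_linear[OF dual.hdeg_mem[OF that]]])
      then show "d_dual \<phi> x = 0" "d_dual \<phi> y = 0"
        using x y by (simp_all add: d_dual_def H_minus_1_def)
    qed
    have zero: "eval2 x y (word (vs[k := d_dual (vs ! k)])) = 0" if k: "k < length vs" for k
    proof (cases "length vs = 2")
      case True
      then obtain \<phi> \<psi> where "vs = [\<phi>, \<psi>]" by (auto simp: length_2_conv)
      with k vs(2) vanish show ?thesis by (auto simp: less_Suc_eq eval2_word)
    qed (simp add: eval2_word)
    have "eval2 x y (free_derivation_word Vd (l_dual scale F l 1) vs - d_dual.leibniz_sum vs ?ds) = 0"
      by (intro eval2_null homogeneous_xy d_dual.free_derivation_word_leibniz dual.list_all2_hdeg vs)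
    then have "eval2 x y (free_derivation Vd (l_dual scale F l 1) q) = eval2 x y (d_dual.leibniz_sum vs ?ds)"
      unfolding vs free_derivation_word_eq by (simp add: eval2_linear)
    also have "\<dots> = 0"
      unfolding d_dual.leibniz_sum_def by (simp add: eval2_linear zero)
    finally show ?case
      using step by (simp only: D.add D.scale eval2_linear) simp
  qed (simp only: D.zero eval2_linear)
qed

text \<open>The derivation dual to the binary bracket makes words longer by one letter, so only the
  one-letter part of \<open>p\<close> reaches the pairing with two vectors, and there
  \<open>l_dual_2\<close> applies.\<close>

lemma eval2_cocycles_delta_1:
  assumes "p \<in> dual.homogeneous_span"
  shows "eval2 x y (free_derivation Vd (l_dual scale F l 2) p) = eval1 (bracket2 x y) p"
proof -
  let ?g = "l_dual scale F l 2"
  interpret D: Vector_Spaces.linear fscale fscale "free_derivation Vd ?g"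
    by (rule linear_free_derivation)
  have lin: "Vector_Spaces.linear fscale (*) (\<lambda>p. eval2 x y (free_derivation Vd ?g p))"
    by (rule linear_functionalI[OF free_alg.vector_space_axioms])
      (simp_all add: D.add D.scale eval2_linear)
  show ?thesis
  proof (rule linear_eq_on_homogeneous_span[OF lin linear_eval1 _ assms])
    fix \<phi>s assume hom: "set \<phi>s \<subseteq> homogeneous Vd"
    show "eval2 x y (free_derivation Vd ?g (word \<phi>s)) = eval1 (bracket2 x y) (word \<phi>s)"
    proof (cases "length \<phi>s = 1")
      case True
      then obtain \<phi> where \<phi>: "\<phi>s = [\<phi>]" by (auto simp: length_Suc_conv)
      with hom have h: "\<phi> \<in> homogeneous Vd" by simp
      have z: "bracket2 x y \<in> F (- 1)"
        using x y by (intro bracket2_degree) (simp_all add: H_minus_1_def)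
      \<comment> \<open>A functional that is nonzero on a vector of degree -1 has degree 1, so the
        sign in \<open>l_dual\<close> is +1.\<close>
      have "- ((- 1) powi hdeg Vd \<phi>) * \<phi> (bracket2 x y) = \<phi> (bracket2 x y)"
      proof (cases "\<phi> (bracket2 x y) = 0")
        case False
        then have "hdeg Vd \<phi> = 1"
          using dual_vanish[OF dual.hdeg_mem[OF h] z] by auto
        then show ?thesis by simp
      qed simp
      then show ?thesis
        using l_dual_2(2)[OF h homogeneous_xy] unfolding \<phi> free_derivation_generator
        by (simp add: eval1_word)
    next
      case False
      have "eval2 x y (word (take k \<phi>s) * rep (?g (\<phi>s ! k)) * word (drop (Suc k) \<phi>s)) = 0"
        if k: "k < length \<phi>s" for k
      proof -
        let ?us = "take k \<phi>s" and ?ws = "drop (Suc k) \<phi>s"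
        have "?g (\<phi>s ! k) \<in> Sym_pow dual_scale Vd 2"
          using hom k by (intro l_dual_2(1)) auto
        \<comment> \<open>The representative chosen by \<open>rep\<close> may contain words of any
          length; \<open>q\<close> consists of two-letter words, so letters can be counted.\<close>
        then obtain q where q: "?g (\<phi>s ! k) = dual.cls q" "q \<in> free_alg.span (word ` words Vd 2)"
          unfolding Sym_pow_def by blast
        have "word ?us * (rep (?g (\<phi>s ! k)) - q) * word ?ws \<in> dual.null"
          unfolding q(1) using hom
          by (intro dual.null_ideal dual.rep_cls) (auto dest: in_set_takeD in_set_dropD)
        from eval2_null[OF homogeneous_xy this]
        have "eval2 x y (word ?us * rep (?g (\<phi>s ! k)) * word ?ws) = eval2 x y (word ?us * q * word ?ws)"
          by (simp add: left_diff_distrib right_diff_distrib eval2_linear)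
        also have "\<dots> = 0"
          using q(2)
        proof (induction rule: free_alg.span_induct_alt)
          case (step c r q)
          then obtain ts where ts: "r = word ts" "length ts = 2" by (auto simp: words_def)
          have "eval2 x y (word ?us * r * word ?ws) = 0"
            using False k ts unfolding ts(1) word_append[symmetric] by (simp add: eval2_word)
          with step show ?case
            by (simp add: distrib_left distrib_right mult_fscale_left word_mult_fscale eval2_linear)
        qed (simp add: eval2_linear)
        finally show ?thesis .
      qed
      then show ?thesis
        using False
        by (simp add: free_derivation_word_eq free_derivation_word_def eval2_linear eval1_word)
    qed
  qed
qed

lemma eval2_rep_sym_add: "eval2 x y (rep (sym_add dual_scale Vd A B)) = eval2 x y (rep A) + eval2 x y (rep B)"
  by (simp add: sym_add_def eval2_rep_cls homogeneous_xy eval2_linear)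

lemma eval2_rep_sym_sum: "eval2 x y (rep (sym_sum dual_scale Vd A I)) = (\<Sum>i\<in>I. eval2 x y (rep (A i)))"
  by (simp add: sym_sum_def eval2_rep_cls homogeneous_xy eval2_linear)

lemma eval2_rep_l_derivation_1:
  "A \<in> Sym dual_scale Vd \<Longrightarrow> eval2 x y (rep (l_derivation scale F l 1 A)) = 0"
  unfolding l_derivation_def sym_derivation_def
  by (simp only: eval2_rep_cls homogeneous_xy eval2_cocycles_delta_0 dual.rep_homogeneous_span)

lemma eval2_rep_l_derivation_2:
  "A \<in> Sym dual_scale Vd \<Longrightarrow>
    eval2 x y (rep (l_derivation scale F l 2 A)) = eval1 (bracket2 x y) (rep A)"
  unfolding l_derivation_def sym_derivation_def
  by (simp only: eval2_rep_cls homogeneous_xy eval2_cocycles_delta_1 dual.rep_homogeneous_span)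

end

text \<open>Lets \<open>\<delta>\<^sub>0\<close> be computed on any representative; it serves to see
  that \<open>\<phi>\<close> and the zero class go to the zero class.\<close>

lemma l_derivation_1_cls:
  "l_derivation scale F l 1 (dual.cls p) = dual.cls (free_derivation Vd (l_dual scale F l 1) p)"
proof -
  interpret D: Vector_Spaces.linear fscale fscale "free_derivation Vd (l_dual scale F l 1)"
    by (rule linear_free_derivation)
  show ?thesis
    unfolding l_derivation_def sym_derivation_def dual.cls_eq_iff
    using d_dual.free_derivation_null[OF dual.rep_cls[of p]] by (simp only: D.diff)
qed

lemma moller_map_bracket2:
  assumes K: "moller_map scale F l K" and x: "x \<in> H_minus_1 F d" and y: "y \<in> H_minus_1 F d"
    and \<phi>: "\<phi> \<in> Vd 1"
  shows "\<phi> (bracket2 x y) = 0"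
proof -
  let ?Sym = "Sym dual_scale Vd" and ?E = "\<lambda>A. eval2 x y (rep A)"
  note hom = homogeneous_xy[OF x y] dual.homogeneousI[OF \<phi>]
  define A where "A = monomial dual_scale Vd [\<phi>]"
  \<comment> \<open>The constant power series \<phi>, on which the identity is compared in order
    one.\<close>
  define f where "f m = (if m = 0 then A else dual.cls 0)" for m :: nat
  have zero_Sym: "dual.cls 0 \<in> ?Sym"
    unfolding dual.Sym_eq by (intro imageI free_alg.subspace_0 dual.subspace_homogeneous_span)
  have A_Sym: "A \<in> ?Sym"
    unfolding A_def dual.Sym_eq by (intro imageI dual.word_homogeneous_span) (use hom in simp)
  have f_Sym: "f m \<in> ?Sym" for m by (simp add: f_def zero_Sym A_Sym)
  note K_parts = K[unfolded moller_map_def]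
  note K_deg_0 = K_parts[THEN conjunct1, THEN spec, unfolded sym_endomorphism_deg_0_def]
  have K_Sym: "K n B \<in> ?Sym" if "B \<in> ?Sym" for n B
    using K_deg_0[THEN conjunct1] that by (rule bspec)
  have K_0: "K 0 B = B" if "B \<in> ?Sym" for B
    using K_parts[THEN conjunct2, THEN conjunct1] that by (rule bspec)
  \<comment> \<open>\<open>dual.cls 0\<close> is the zero of \<open>Sym\<close>. Linearity of
    \<open>K n\<close> refers to the operations of \<open>Sym\<close>, so zero is reached as a
    multiple by the scalar 0.\<close>
  have K_zero: "K n (dual.cls 0) = dual.cls 0" for n
  proof -
    have "sym_scale dual_scale Vd 0 B = dual.cls 0" for B
      by (simp add: sym_scale_def)
    moreover have "K n (sym_scale dual_scale Vd 0 (dual.cls 0)) = sym_scale dual_scale Vd 0 (K n (dual.cls 0))"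
      using K_deg_0[THEN conjunct2, THEN conjunct2, THEN conjunct1] zero_Sym by (simp only: Ball_def)
    ultimately show ?thesis by (simp only:)
  qed
  have E_zero: "?E (dual.cls 0) = 0"
    by (simp add: eval2_rep_cls hom eval2_linear)
  have series_Sym: "series_map scale F K f m \<in> ?Sym" for m
    unfolding series_map_def sym_sum_def dual.Sym_eq
    by (intro imageI free_alg.subspace_sum dual.subspace_homogeneous_span
        dual.rep_homogeneous_span K_Sym f_Sym)
  have closed: "l_derivation scale F l 1 A = dual.cls 0"
  proof -
    have "d_dual \<phi> = 0"
      using dual_2_trivial d_dual_degree[OF \<phi>] by simp
    then have "rep (l_dual scale F l 1 \<phi>) - word [0] \<in> dual.null"
      using l_dual_1[OF hom(3)] dual.rep_cls by metis
    moreover have "word [0] \<in> dual.null" by (simp add: dual.null_zero_letter)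
    ultimately show ?thesis
      unfolding A_def l_derivation_1_cls free_derivation_generator dual.cls_eq_iff
      using dual.null_add by fastforce
  qed
  have closed_0: "l_derivation scale F l 1 (dual.cls 0) = dual.cls 0"
  proof -
    interpret D: Vector_Spaces.linear fscale fscale "free_derivation Vd (l_dual scale F l 1)"
      by (rule linear_free_derivation)
    show ?thesis unfolding l_derivation_1_cls by (simp only: D.zero)
  qed
  \<comment> \<open>The dual of \<open>l n\<close> comes with the power n - 1 of \<lambda>, so in
    order one only n = 2 occurs, applied to the coefficient of order zero.\<close>
  have orders: "{n::nat. n \<ge> 2 \<and> n - 1 \<le> 1} = {2}" by auto
  have "f \<in> Sym_series dual_scale Vd" by (simp add: Sym_series_def f_Sym)
  then have "?E (delta_CE scale F l (series_map scale F K f) 1) = ?E (series_map scale F K (delta_0 scale F l f) 1)"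
    using bspec[OF K_parts[THEN conjunct2, THEN conjunct2]] by (simp only:)
  moreover have "?E (series_map scale F K (delta_0 scale F l f) 1) = 0"
  proof -
    have "delta_0 scale F l f = (\<lambda>_. dual.cls 0)"
      unfolding delta_0_def f_def using closed closed_0 by (intro ext) (simp only: simp_thms split: if_split)
    then show ?thesis
      unfolding series_map_def by (simp only: eval2_rep_sym_sum[OF x y] K_zero E_zero sum.neutral_const)
  qed
  moreover have "?E (delta_CE scale F l (series_map scale F K f) 1) = \<phi> (bracket2 x y)"
  proof -
    have "?E (delta scale F l (series_map scale F K f) 1)
        = eval1 (bracket2 x y) (rep (series_map scale F K f 0))"
      unfolding delta_def eval2_rep_sym_sum[OF x y] orders
      by (simp add: eval2_rep_l_derivation_2[OF x y series_Sym])
    \<comment> \<open>In order zero the image of \<open>f\<close> is \<open>K 0 A\<close>, which is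
      \<open>A\<close>.\<close>
    also have "\<dots> = \<phi> (bracket2 x y)"
      by (simp add: series_map_def sym_sum_def eval1_rep_cls K_0 f_Sym)
        (simp add: f_def A_def eval1_rep_cls eval1_word)
    \<comment> \<open>\<open>K 1 A\<close> enters only through \<open>delta_0\<close>, whose values
      pair to zero with the cocycles.\<close>
    finally show ?thesis
      unfolding delta_CE_def eval2_rep_sym_add[OF x y] delta_0_def
      by (simp only: eval2_rep_l_derivation_1[OF x y series_Sym] add_0_left)
  qed
  ultimately show ?thesis by simp
qed

end

theorem theorem4p6:
  fixes scale :: "'k::real_or_complex \<Rightarrow> 'v::ab_group_add \<Rightarrow> 'v"
    and F :: "int \<Rightarrow> 'v set"
    and d :: "'v \<Rightarrow> 'v"
    and l :: "nat \<Rightarrow> ('v, 'k) sym \<Rightarrow> 'v"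
    and N :: int
  assumes "Linf1_algebra scale F d l"
    and "N \<ge> - 1"
    and "\<And>i. i \<notin> {- 1..N} \<Longrightarrow> F i = {0}"
    and "\<And>i. \<exists>B. finite B \<and> module.span scale B = F i"
    and "\<exists>A \<in> wedge2_H scale F d. l 2 A \<noteq> 0"
  shows "\<not> (\<exists>K. moller_map scale F l K)"
proof
  interpret Linf1_algebra scale F d l by fact
  interpret finite_Linf1_algebra scale F d l
  proof
    show "F i = {0}" if "i < - 1" for i using assms(3)[of i] that by simp
    have "{i. F i \<noteq> {0}} \<subseteq> {- 1..N}" using assms(3) by blast
    then show "finite {i. F i \<noteq> {0}}" by (rule finite_subset) simp
    show "\<exists>B. finite B \<and> module.span scale B = F i" for i by (rule assms(4))
  qed
  assume "\<exists>K. moller_map scale F l K"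
  then obtain K where K: "moller_map scale F l K" ..
  obtain x y where xy: "x \<in> H_minus_1 F d" "y \<in> H_minus_1 F d" and nz: "bracket2 x y \<noteq> 0"
    using assms(5) wedge2_nonvanishing by blast
  have "bracket2 x y \<in> F (- 1)"
    using xy by (intro bracket2_degree) (simp_all add: H_minus_1_def)
  then obtain \<phi> where "\<phi> \<in> Vd (- (- 1))" "\<phi> (bracket2 x y) \<noteq> 0"
    using nz by (rule exists_dual_nonzero)
  then show False using moller_map_bracket2[OF K xy] by simp
qed

end
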